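(* Let $d\ge 1$ be an integer, let $\sigma^2>0$ and $\kappa>0$, and let $\alpha>d/2$ be a non-integer. Let $X$ be the band-limited fractional Matérn field on $\mathbb{R}^d$, i.e. the solution of $$\left(-\Delta+\kappa^2\right)^{\frac{\alpha}{2}}X=W,$$ where $W$ is the zero-mean Gaussian spectrally truncated white noise on $\mathbb{R}^d$ with covariance function $$C_W(x,y)=\frac{\sigma^2}{(2\pi)^d}\int_{|\xi|\le\kappa}\exp\left(-i(x-y)\cdot\xi\right)d\xi .$$ Then the sample paths of $X$ are smooth (infinitely differentiable) on $\mathbb{R}^d$ with probability $1$.
   Context: The operator $(-\Delta+\kappa^2)^{\alpha/2}$ is the pseudodifferential operator with Fourier symbol $(\kappa^2+|\xi|^2)^{\alpha/2}$. The solution $X$ is the zero-mean Gaussian random field on $\mathbb{R}^d$ with covariance function $$C_X(x,y)=\frac{\sigma^2}{(2\pi)^d}\int_{|\xi|\le\kappa}\frac{\exp\left(-i(x-y)\cdot\xi\right)}{(\kappa^2+|\xi|^2)^{\alpha}}\,d\xi .$$ As usual for Gaussian fields specified through their covariance function, sample path properties are understood for a suitable version (modification) of the field. *)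

theory Defs
  imports "HOL-Probability.Probability"
begin

text \<open>
  Fields on R^d are indexed by \<^typ>\<open>real ^ 'n\<close>, with d rendered as \<open>CARD('n)\<close>
  (so d \<open>\<ge>\<close> 1 holds automatically).
\<close>

section \<open>Gaussian random fields\<close>

text \<open>Constants count as (degenerate) Gaussian random variables.\<close>

definition gaussian_rv :: "'w measure \<Rightarrow> ('w \<Rightarrow> real) \<Rightarrow> bool" where
  "gaussian_rv M Z \<longleftrightarrow> Z \<in> borel_measurable M \<and>
     ((\<exists>\<mu> s. s > 0 \<and> distributed M lborel Z (\<lambda>t. ennreal (normal_density \<mu> s t)))
      \<or> (\<exists>c. AE \<omega> in M. Z \<omega> = c))"

text \<open>
  A field is Gaussian if its finite-dimensional distributions are (possibly degenerate)
  multivariate normal, i.e. if all finite linear combinations of its values are Gaussian.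
\<close>

definition gaussian_field :: "'w measure \<Rightarrow> ('a \<Rightarrow> 'w \<Rightarrow> real) \<Rightarrow> bool" where
  "gaussian_field M X \<longleftrightarrow>
     (\<forall>S c. finite S \<longrightarrow> gaussian_rv M (\<lambda>\<omega>. \<Sum>x\<in>S. c x * X x \<omega>))"

text \<open>
  The covariance is \<^typ>\<open>complex\<close>-valued because it is specified by Fourier integrals;
  the field itself is real, so the condition also says that these integrals are real.
\<close>

definition zero_mean_gaussian_field ::
    "'w measure \<Rightarrow> ('a \<Rightarrow> 'w \<Rightarrow> real) \<Rightarrow> ('a \<Rightarrow> 'a \<Rightarrow> complex) \<Rightarrow> bool" where
  "zero_mean_gaussian_field M X C \<longleftrightarrow>
     gaussian_field M X \<and>
     (\<forall>x. (\<integral>\<omega>. X x \<omega> \<partial>M) = 0) \<and>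
     (\<forall>x y. complex_of_real (\<integral>\<omega>. X x \<omega> * X y \<omega> \<partial>M) = C x y)"

definition modification ::
    "'w measure \<Rightarrow> ('a \<Rightarrow> 'w \<Rightarrow> real) \<Rightarrow> ('a \<Rightarrow> 'w \<Rightarrow> real) \<Rightarrow> bool" where
  "modification M Y X \<longleftrightarrow>
     (\<forall>x. Y x \<in> borel_measurable M) \<and> (\<forall>x. AE \<omega> in M. Y x \<omega> = X x \<omega>)"

section \<open>The band-limited fractional Mat\'ern field\<close>

definition noise_covariance ::
    "real \<Rightarrow> real \<Rightarrow> (real ^ 'n) \<Rightarrow> (real ^ 'n) \<Rightarrow> complex" where
  "noise_covariance \<sigma> \<kappa> x y =
     complex_of_real (\<sigma>\<^sup>2 / (2 * pi) ^ CARD('n)) *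
     (LINT \<xi>:cball 0 \<kappa>|lborel. exp (- \<i> * complex_of_real ((x - y) \<bullet> \<xi>)))"

definition matern_covariance ::
    "real \<Rightarrow> real \<Rightarrow> real \<Rightarrow> (real ^ 'n) \<Rightarrow> (real ^ 'n) \<Rightarrow> complex" where
  "matern_covariance \<sigma> \<kappa> \<alpha> x y =
     complex_of_real (\<sigma>\<^sup>2 / (2 * pi) ^ CARD('n)) *
     (LINT \<xi>:cball 0 \<kappa>|lborel. exp (- \<i> * complex_of_real ((x - y) \<bullet> \<xi>))
         / complex_of_real ((\<kappa>\<^sup>2 + (norm \<xi>)\<^sup>2) powr \<alpha>))"

text \<open>Fourier symbol of the operator \<open>(-\<Delta> + \<kappa>\<^sup>2)\<^bsup>\<alpha>/2\<^esup>\<close>.\<close>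

definition operator_symbol :: "real \<Rightarrow> real \<Rightarrow> (real ^ 'n) \<Rightarrow> real" where
  "operator_symbol \<kappa> \<alpha> \<xi> = (\<kappa>\<^sup>2 + (norm \<xi>)\<^sup>2) powr (\<alpha> / 2)"

text \<open>
  The solution of \<open>(-\<Delta> + \<kappa>\<^sup>2)\<^bsup>\<alpha>/2\<^esup> X = W\<close>, with W the spectrally truncated white noise
  (covariance \<^const>\<open>noise_covariance\<close>), is understood in law: it is the zero-mean Gaussian
  field whose spectral density is that of W divided by the squared symbol of the operator.
  The two lemmas below check that this is \<^const>\<open>matern_covariance\<close>.
\<close>

definition band_limited_matern_field ::
    "'w measure \<Rightarrow> real \<Rightarrow> real \<Rightarrow> real \<Rightarrow> (real ^ 'n \<Rightarrow> 'w \<Rightarrow> real) \<Rightarrow> bool" where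
  "band_limited_matern_field M \<sigma> \<kappa> \<alpha> X \<longleftrightarrow>
     zero_mean_gaussian_field M X (matern_covariance \<sigma> \<kappa> \<alpha>)"

definition noise_spectral_density :: "real \<Rightarrow> real \<Rightarrow> (real ^ 'n) \<Rightarrow> real" where
  "noise_spectral_density \<sigma> \<kappa> \<xi> = \<sigma>\<^sup>2 / (2 * pi) ^ CARD('n) * indicator (cball 0 \<kappa>) \<xi>"

lemma noise_covariance_spectral:
  "noise_covariance \<sigma> \<kappa> x (y :: real ^ 'n) =
     (LINT \<xi>|lborel. exp (- \<i> * complex_of_real ((x - y) \<bullet> \<xi>)) *
        complex_of_real (noise_spectral_density \<sigma> \<kappa> \<xi>))"
  unfolding noise_covariance_def noise_spectral_density_def set_lebesgue_integral_def
    integral_mult_right_zero[symmetric]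
  by (rule Bochner_Integration.integral_cong) (auto simp: indicator_def)

lemma matern_covariance_spectral:
  "matern_covariance \<sigma> \<kappa> \<alpha> x (y :: real ^ 'n) =
     (LINT \<xi>|lborel. exp (- \<i> * complex_of_real ((x - y) \<bullet> \<xi>)) *
        complex_of_real (noise_spectral_density \<sigma> \<kappa> \<xi> / (operator_symbol \<kappa> \<alpha> \<xi>)\<^sup>2))"
proof -
  have "((\<kappa>\<^sup>2 + (norm \<xi>)\<^sup>2) powr (\<alpha> / 2))\<^sup>2 = (\<kappa>\<^sup>2 + (norm \<xi>)\<^sup>2) powr \<alpha>" for \<xi> :: "real ^ 'n"
    by (simp add: power2_eq_square flip: powr_add)
  then show ?thesis
    unfolding matern_covariance_def noise_spectral_density_def operator_symbol_def
      set_lebesgue_integral_def integral_mult_right_zero[symmetric]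
    by (intro Bochner_Integration.integral_cong) (auto simp: indicator_def)
qed

section \<open>Smooth functions\<close>

text \<open>
  n-times continuously differentiable functions: f is differentiable everywhere and all
  its directional derivatives are (n - 1)-times continuously differentiable.
\<close>

primrec C_k :: "nat \<Rightarrow> ('a::real_normed_vector \<Rightarrow> real) \<Rightarrow> bool" where
  "C_k 0 f \<longleftrightarrow> continuous_on UNIV f"
| "C_k (Suc n) f \<longleftrightarrow> (\<forall>x. f differentiable (at x)) \<and>
     (\<forall>v. C_k n (\<lambda>x. frechet_derivative f (at x) v))"

definition smooth :: "('a::real_normed_vector \<Rightarrow> real) \<Rightarrow> bool" where
  "smooth f \<longleftrightarrow> (\<forall>n. C_k n f)"

end

theory Submission
  imports Defs "HOL-Complex_Analysis.Complex_Analysis"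
begin

text \<open>
  The spectral measure of the field lives on the ball of radius \<open>\<kappa>\<close>, so the field is determined by
  its finite differences at the origin with a fixed small step.
  Take \<open>h = 1 / (8 * \<kappa>)\<close>. For \<open>\<xi>\<close> in the ball each
  \<open>u\<^sub>j = exp (- \<i> * h * \<xi>\<^sub>j) - 1\<close> has modulus at most \<open>1/8\<close>, and the binomial series gives
  \<open>exp (- \<i> * (x \<bullet> \<xi>)) = \<Prod>\<^sub>j (1 + u\<^sub>j) powr (x\<^sub>j / h) = \<Sum>\<^sub>i N\<^sub>i(x) * \<Prod>\<^sub>j u\<^sub>j ^ i\<^sub>j\<close>
  uniformly on the ball, with \<open>i\<close> ranging over multi-indices and \<open>N\<^sub>i\<close> the Newton polynomials
  (\<open>newton_expansion\<close>, \<open>character_newton_expansion\<close>).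

  The covariance formula says that \<open>X x \<mapsto> (\<xi> \<mapsto> exp (- \<i> * (x \<bullet> \<xi>)))\<close> extends to an isometry
  from the span of the field to the \<open>L\<^sup>2\<close> space of the spectral density
  (\<open>combination_isometry\<close>). Under it, \<open>\<Prod>\<^sub>j u\<^sub>j ^ i\<^sub>j\<close> is the image of a random variable \<open>Z\<^sub>i\<close>, a finite
  difference of \<open>X\<close> at the origin, and \<open>E |Z\<^sub>i|\<close> is at most of order \<open>8\<^sup>-\<^sup>|\<^sup>i\<^sup>|\<close>. The series
  \<open>\<Sum>\<^sub>i Z\<^sub>i * N\<^sub>i(x)\<close> therefore converges to \<open>X x\<close> in mean square, and its real part \<open>Y x\<close> is the
  modification sought (\<open>spectral_field_smooth_modification\<close>).

  The paths of \<open>Y\<close> are smooth for the following reason. Almost surely \<open>\<Sum>\<^sub>i |Z\<^sub>i| * 4\<^sup>|\<^sup>i\<^sup>|\<close>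
  is finite. By Cauchy's formula
  on the torus \<open>|z\<^sub>j| = 1/4\<close>, the polynomial \<open>N\<^sub>i(x)\<close> is the mean of \<open>\<Prod>\<^sub>j (1 + z\<^sub>j) powr (x\<^sub>j / h) / z\<^sub>j ^ i\<^sub>j\<close>.
  Summing inside the integral, \<open>Y x\<close> is the real part of an integral of exponentials whose exponents
  are linear in \<open>x\<close>, with bounded frequencies \<open>Ln (1 + z\<^sub>j) / h\<close>, against an integrable random weight. Such functions are
  differentiable, and their directional derivatives are of the same form (\<open>smooth_exp_superposition\<close>).
\<close>

section \<open>Superpositions of exponentials are smooth\<close>

lemma norm_exp_remainder_le:
  "norm (exp z - 1 - z) \<le> exp (norm z) * (norm z)\<^sup>2" for z :: complex
proof -
  have "norm (exp z - (\<Sum>i\<le>1. z ^ i / fact i)) \<le> exp (norm z) * (norm z ^ Suc 1) / fact 1"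
    by (rule Taylor_exp_field)
  then show ?thesis
    by (simp add: power2_eq_square algebra_simps)
qed

lemma integrable_bounded_mult:
  fixes G g :: "'t \<Rightarrow> complex"
  assumes G: "integrable N G" and [measurable]: "g \<in> borel_measurable N"
    and b: "\<And>t. t \<in> space N \<Longrightarrow> norm (g t) \<le> B"
  shows "integrable N (\<lambda>t. g t * G t)"
proof -
  have [measurable]: "G \<in> borel_measurable N" using G by simp
  have "integrable N (\<lambda>t. B * norm (G t))" using G by simp
  then show ?thesis
  proof (rule Bochner_Integration.integrable_bound)
    have "norm (g t * G t) \<le> norm (B * norm (G t))" if "t \<in> space N" for t
      using mult_right_mono[OF b[OF that] norm_ge_zero[of "G t"]]
      unfolding norm_mult real_norm_def by linarith
    then show "AE t in N. norm (g t * G t) \<le> norm (B * norm (G t))" by simp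
  qed simp
qed

lemma norm_integral_le:
  fixes f :: "'t \<Rightarrow> complex"
  assumes "integrable N f" "integrable N g" "\<And>t. t \<in> space N \<Longrightarrow> norm (f t) \<le> g t"
  shows "norm (integral\<^sup>L N f) \<le> integral\<^sup>L N g"
proof -
  have "norm (integral\<^sup>L N f) \<le> (\<integral>t. norm (f t) \<partial>N)" by (rule integral_norm_bound)
  also have "\<dots> \<le> integral\<^sup>L N g" using assms by (intro integral_mono) auto
  finally show ?thesis .
qed

text \<open>
  Differentiation under the integral sign, with an explicit remainder: \<open>L\<close> is linear in its first
  argument, so \<open>L y t = L x t + z\<close> with \<open>norm z \<le> \<bar>K\<bar> * norm (y - x)\<close>, and the second-order bound for
  \<open>exp z\<close> makes the error quadratic in \<open>y - x\<close>, uniformly in \<open>t\<close>.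
\<close>

lemma has_derivative_exp_superposition:
  fixes L :: "'a::real_normed_vector \<Rightarrow> 't \<Rightarrow> complex" and G :: "'t \<Rightarrow> complex"
  assumes L: "\<And>t. t \<in> space N \<Longrightarrow> linear (\<lambda>v. L v t)"
    and LB: "\<And>v t. t \<in> space N \<Longrightarrow> norm (L v t) \<le> K * norm v"
    and [measurable]: "\<And>v. L v \<in> borel_measurable N"
    and G: "integrable N G"
  shows "((\<lambda>x. \<integral>t. exp (L x t) * G t \<partial>N) has_derivative
          (\<lambda>v. \<integral>t. exp (L x t) * (L v t * G t) \<partial>N)) (at x)"
proof -
  have K0: "norm (L v t) \<le> \<bar>K\<bar> * norm v" if "t \<in> space N" for v t
    using LB[OF that, of v] by (smt (verit) abs_ge_self mult_right_mono norm_ge_zero)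
  have [measurable]: "G \<in> borel_measurable N" using G by simp
  have LG: "integrable N (\<lambda>t. L v t * G t)" for v
    by (rule integrable_bounded_mult[OF G _ K0]) auto
  have ex: "norm (exp (L y t)) \<le> exp (\<bar>K\<bar> * norm y)" if "t \<in> space N" for y t
    using norm_exp[of "L y t"] K0[OF that, of y] by (smt (verit) exp_le_cancel_iff)
  have ELG: "integrable N (\<lambda>t. exp (L y t) * (L v t * G t))" for y v
    by (rule integrable_bounded_mult[OF LG _ ex]) auto
  have EG: "integrable N (\<lambda>t. exp (L y t) * G t)" for y
    by (rule integrable_bounded_mult[OF G _ ex]) auto
  define F where "F y = (\<integral>t. exp (L y t) * G t \<partial>N)" for y
  define F' where "F' v = (\<integral>t. exp (L x t) * (L v t * G t) \<partial>N)" for v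
  define I where "I = (\<integral>t. norm (G t) \<partial>N)"
  have I0: "I \<ge> 0" unfolding I_def by simp
  have nF': "norm (F' v) \<le> norm v * (exp (\<bar>K\<bar> * norm x) * \<bar>K\<bar> * I)" for v
  proof -
    have "norm (F' v) \<le> (\<integral>t. exp (\<bar>K\<bar> * norm x) * (\<bar>K\<bar> * norm v) * norm (G t) \<partial>N)"
      unfolding F'_def
    proof (rule norm_integral_le[OF ELG])
      show "norm (exp (L x t) * (L v t * G t)) \<le> exp (\<bar>K\<bar> * norm x) * (\<bar>K\<bar> * norm v) * norm (G t)"
        if "t \<in> space N" for t
        unfolding norm_mult mult.assoc[symmetric] using mult_mono[OF ex[OF that, of x] K0[OF that, of v]]
        by (intro mult_right_mono) (auto simp: mult.assoc)
    qed (use G in simp)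
    then show ?thesis by (simp add: I_def mult_ac)
  qed
  have bl: "bounded_linear F'"
  proof (rule bounded_linear_intro)
    show "F' (u + v) = F' u + F' v" for u v
    proof -
      have "F' (u + v) = (\<integral>t. exp (L x t) * (L u t * G t) + exp (L x t) * (L v t * G t) \<partial>N)"
        unfolding F'_def
        by (rule Bochner_Integration.integral_cong) (auto simp: linear_add[OF L] algebra_simps)
      then show ?thesis unfolding F'_def using ELG by simp
    qed
    show "F' (r *\<^sub>R v) = r *\<^sub>R F' v" for r v
    proof -
      have "F' (r *\<^sub>R v) = (\<integral>t. r *\<^sub>R (exp (L x t) * (L v t * G t)) \<partial>N)"
        unfolding F'_def
        by (rule Bochner_Integration.integral_cong) (auto simp: linear_scale[OF L])
      then show ?thesis unfolding F'_def by simp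
    qed
  qed (rule nF')
  define C where "C = exp (\<bar>K\<bar> * norm x) * exp \<bar>K\<bar> * K\<^sup>2 * I"
  have rem: "norm (F y - F x - F' (y - x)) \<le> C * (norm (y - x))\<^sup>2" if "norm (y - x) \<le> 1" for y
  proof -
    have "F y - F x - F' (y - x)
        = (\<integral>t. exp (L y t) * G t - exp (L x t) * G t - exp (L x t) * (L (y - x) t * G t) \<partial>N)"
      unfolding F_def F'_def using EG ELG by simp
    also have "norm \<dots> \<le> (\<integral>t. (exp (\<bar>K\<bar> * norm x) * exp \<bar>K\<bar> * K\<^sup>2 * (norm (y - x))\<^sup>2) * norm (G t) \<partial>N)"
    proof (rule norm_integral_le)
      fix t assume t: "t \<in> space N"
      define z where "z = L (y - x) t"
      have z: "norm z \<le> \<bar>K\<bar> * norm (y - x)" unfolding z_def by (rule K0[OF t])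
      have z1: "norm z \<le> \<bar>K\<bar>" using z that by (smt (verit) mult_left_le)
      have "L y t = L x t + z" unfolding z_def using linear_add[OF L[OF t], of x "y - x"] by simp
      then have "exp (L y t) * G t - exp (L x t) * G t - exp (L x t) * (L (y - x) t * G t)
          = exp (L x t) * (exp z - 1 - z) * G t"
        by (simp add: exp_add z_def algebra_simps)
      also have "norm \<dots> = norm (exp (L x t)) * norm (exp z - 1 - z) * norm (G t)"
        by (simp add: norm_mult)
      also have "\<dots> \<le> exp (\<bar>K\<bar> * norm x) * (exp \<bar>K\<bar> * (\<bar>K\<bar> * norm (y - x))\<^sup>2) * norm (G t)"
      proof (intro mult_mono ex[OF t] order_refl)
        have "norm (exp z - 1 - z) \<le> exp (norm z) * (norm z)\<^sup>2" by (rule norm_exp_remainder_le)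
        also have "\<dots> \<le> exp \<bar>K\<bar> * (\<bar>K\<bar> * norm (y - x))\<^sup>2"
          using z z1 by (intro mult_mono power_mono) auto
        finally show "norm (exp z - 1 - z) \<le> exp \<bar>K\<bar> * (\<bar>K\<bar> * norm (y - x))\<^sup>2" .
      qed auto
      finally show "norm (exp (L y t) * G t - exp (L x t) * G t - exp (L x t) * (L (y - x) t * G t))
        \<le> (exp (\<bar>K\<bar> * norm x) * exp \<bar>K\<bar> * K\<^sup>2 * (norm (y - x))\<^sup>2) * norm (G t)"
        by (simp add: power_mult_distrib mult_ac)
    qed (use EG ELG G in auto)
    also have "\<dots> = C * (norm (y - x))\<^sup>2"
      by (simp add: C_def I_def mult_ac)
    finally show ?thesis .
  qed
  have C0: "C \<ge> 0" unfolding C_def using I0 by simp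
  have "(F has_derivative F') (at x)"
  proof (rule has_derivativeI_sandwich[of 1])
    show "((\<lambda>y. C * norm (y - x)) \<longlongrightarrow> 0) (at x)"
      by (rule tendsto_eq_intros refl | simp)+
    show "norm (F y - F x - F' (y - x)) / norm (y - x) \<le> C * norm (y - x)"
      if "y \<in> UNIV" "y \<noteq> x" "dist y x < 1" for y
      using rem[of y] that by (simp add: dist_norm field_simps power2_eq_square)
  qed (use bl in auto)
  then show ?thesis unfolding F_def F'_def .
qed

text \<open>
  The derivative in direction \<open>v\<close> is again a superposition of the same exponentials, with the
  integrable weight \<open>G\<close> replaced by \<open>L v t * G t\<close>. The class of such functions is therefore closed
  under directional derivatives, which is all that smoothness asks for.
\<close>

lemma smooth_exp_superposition:
  fixes L :: "'a::real_normed_vector \<Rightarrow> 't \<Rightarrow> complex" and G :: "'t \<Rightarrow> complex"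
  assumes L: "\<And>t. t \<in> space N \<Longrightarrow> linear (\<lambda>v. L v t)"
    and LB: "\<And>v t. t \<in> space N \<Longrightarrow> norm (L v t) \<le> K * norm v"
    and [measurable]: "\<And>v. L v \<in> borel_measurable N"
    and G: "integrable N G"
  shows "smooth (\<lambda>x. Re (\<integral>t. exp (L x t) * G t \<partial>N))"
proof -
  have d: "((\<lambda>x. Re (\<integral>t. exp (L x t) * G t \<partial>N)) has_derivative
      (\<lambda>v. Re (\<integral>t. exp (L x t) * (L v t * G t) \<partial>N))) (at x)" if "integrable N G" for x G
    using has_derivative_exp_superposition[OF L LB assms(3) that]
    by (rule bounded_linear.has_derivative[OF bounded_linear_Re])
  have "C_k n (\<lambda>x. Re (\<integral>t. exp (L x t) * G t \<partial>N))" for n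
    using G
  proof (induction n arbitrary: G)
    case 0
    then show ?case
      using has_derivative_continuous[OF d[OF 0]] by (simp add: continuous_on_eq_continuous_at)
  next
    case (Suc n)
    have fd: "frechet_derivative (\<lambda>x. Re (\<integral>t. exp (L x t) * G t \<partial>N)) (at x)
        = (\<lambda>v. Re (\<integral>t. exp (L x t) * (L v t * G t) \<partial>N))" for x
      using frechet_derivative_at[OF d[OF Suc.prems, of x]] by simp
    have "C_k n (\<lambda>x. Re (\<integral>t. exp (L x t) * (L v t * G t) \<partial>N))" for v
      by (rule Suc.IH, rule integrable_bounded_mult[OF Suc.prems assms(3) LB])
    moreover have "(\<lambda>x. Re (\<integral>t. exp (L x t) * G t \<partial>N)) differentiable at x" for x
      using d[OF Suc.prems] unfolding differentiable_def by blast
    ultimately show ?case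
      by (simp add: fd)
  qed
  then show ?thesis by (simp add: smooth_def)
qed

section \<open>Cauchy's formula on the circle and geometric series over multi-indices\<close>

text \<open>
  The radius \<open>1/4\<close> is below \<open>1/2\<close>, so that \<open>Ln (1 + w)\<close> is bounded on the circle, and it is twice
  the bound \<open>1/8\<close> on the differences \<open>u\<close> that are expanded below, so that the geometric series in
  \<open>u / w\<close> converges on the circle.
\<close>

definition circle_point :: "real \<Rightarrow> complex" where
  "circle_point t = exp (2 * of_real pi * \<i> * of_real t) / 4"

abbreviation unit_interval :: "real measure" where
  "unit_interval \<equiv> restrict_space lborel {0..1}"

abbreviation torus :: "('n \<Rightarrow> real) measure" where
  "torus \<equiv> Pi\<^sub>M UNIV (\<lambda>_. unit_interval)"

lemma norm_circle_point: "norm (circle_point t) = 1/4"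
  unfolding circle_point_def by (simp add: norm_divide)

lemma circle_point_nonzero: "circle_point t \<noteq> 0"
  using norm_circle_point[of t] by force

lemma measurable_circle_point [measurable]: "circle_point \<in> borel_measurable borel"
  unfolding circle_point_def by (intro borel_measurable_continuous_onI continuous_intros) simp

lemma prob_space_unit_interval: "prob_space unit_interval"
  by (rule prob_spaceI) (simp add: emeasure_restrict_space space_restrict_space)

lemma prob_space_torus: "prob_space (torus :: ('n::finite \<Rightarrow> real) measure)"
  by (intro prob_space_PiM prob_space_unit_interval)

lemma measurable_torus_component [measurable]: "(\<lambda>t. t j) \<in> borel_measurable (torus :: ('n::finite \<Rightarrow> real) measure)"
proof -
  have 1: "(\<lambda>t. t j) \<in> measurable (torus :: ('n::finite \<Rightarrow> real) measure) unit_interval" by simp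
  have 2: "(\<lambda>x. x) \<in> borel_measurable unit_interval" by (simp add: measurable_restrict_space1)
  show ?thesis using measurable_compose[OF 1 2] by simp
qed

text \<open>
  Cauchy's integral formula on the circle of radius \<open>1/4\<close>. Since \<open>dw = 2 * pi * \<i> * w dt\<close>, the
  kernel \<open>dw / (w - u)\<close> becomes \<open>dt / (1 - u / w)\<close> up to the factor \<open>2 * pi * \<i>\<close>; this is the form
  in which the kernel is a geometric series in \<open>u / w\<close>.
\<close>

lemma cauchy_unit_interval:
  fixes f :: "complex \<Rightarrow> complex"
  assumes f: "f holomorphic_on ball 0 1" and u: "norm u < 1/4"
  shows "integrable unit_interval (\<lambda>t. f (circle_point t) / (1 - u / circle_point t))" (is "integrable _ ?F")
    and "(\<integral>t. f (circle_point t) / (1 - u / circle_point t) \<partial>unit_interval) = f u"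
proof -
  have ne: "1 - u / circle_point t \<noteq> 0" for t
  proof
    assume "1 - u / circle_point t = 0"
    then have "u = circle_point t" using circle_point_nonzero[of t] by (simp add: field_simps)
    then show False using u norm_circle_point[of t] by simp
  qed
  have cf: "continuous_on (ball 0 1) f" using f by (rule holomorphic_on_imp_continuous_on)
  have cc: "continuous_on A circle_point" for A
    unfolding circle_point_def by (intro continuous_intros) simp
  have cF: "continuous_on {0..1} ?F"
    by (intro continuous_intros cc continuous_on_compose2[OF cf cc])
       (use ne circle_point_nonzero in \<open>auto simp: norm_circle_point simp del: right_minus_eq\<close>)
  have si: "set_integrable lborel {0..1} ?F"
    by (rule borel_integrable_atLeastAtMost') (rule cF)
  then show "integrable unit_interval ?F"
    by (subst integrable_restrict_space) (auto simp: set_integrable_def)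
  have "((\<lambda>w. f w / (w - u)) has_contour_integral (2 * of_real pi * \<i> * f u)) (circlepath 0 (1/4))"
    by (rule Cauchy_integral_circlepath)
       (use f u in \<open>auto intro!: holomorphic_on_imp_continuous_on elim!: holomorphic_on_subset\<close>)
  then have "((\<lambda>t. f (circlepath 0 (1/4) t) / (circlepath 0 (1/4) t - u)
      * vector_derivative (circlepath 0 (1/4)) (at t)) has_integral (2 * of_real pi * \<i> * f u)) {0..1}"
    unfolding has_contour_integral .
  also have "(\<lambda>t. f (circlepath 0 (1/4) t) / (circlepath 0 (1/4) t - u)
      * vector_derivative (circlepath 0 (1/4)) (at t)) = (\<lambda>t. (2 * of_real pi * \<i>) * ?F t)"
  proof
    fix t
    have c: "circlepath 0 (1/4) t = circle_point t"
      unfolding circlepath circle_point_def by simp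
    have v: "vector_derivative (circlepath 0 (1/4)) (at t) = 2 * of_real pi * \<i> * circle_point t"
      by (simp add: vector_derivative_circlepath circle_point_def)
    have "circle_point t - u \<noteq> 0" using ne[of t] circle_point_nonzero[of t] by (auto simp: field_simps)
    then show "f (circlepath 0 (1/4) t) / (circlepath 0 (1/4) t - u)
      * vector_derivative (circlepath 0 (1/4)) (at t) = (2 * of_real pi * \<i>) * ?F t"
      unfolding c v using ne[of t] circle_point_nonzero[of t] by (simp add: field_simps)
  qed
  finally have "((\<lambda>t. inverse (2 * of_real pi * \<i>) * ((2 * of_real pi * \<i>) * ?F t)) has_integral
      inverse (2 * of_real pi * \<i>) * (2 * of_real pi * \<i> * f u)) {0..1}"
    by (rule has_integral_mult_right)
  moreover have "inverse (2 * of_real pi * \<i>) * ((2 * of_real pi * \<i>) * w) = w" for w :: complex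
    by (simp add: field_simps)
  ultimately have "(?F has_integral f u) {0..1}"
    by (simp only:)
  moreover have "(?F has_integral (LINT t:{0..1}|lborel. ?F t)) {0..1}"
    using set_borel_integral_eq_integral[OF si] by (simp add: has_integral_integral)
  ultimately have "(LINT t:{0..1}|lborel. ?F t) = f u" by (rule has_integral_unique[rotated])
  then show "(\<integral>t. ?F t \<partial>unit_interval) = f u"
    by (subst integral_restrict_space) (auto simp: set_lebesgue_integral_def)
qed

text \<open>
  The series in several variables are indexed by multi-indices. Enumerating these by natural
  numbers once and for all makes the usual convergence and measurability results for series over
  \<^typ>\<open>nat\<close> available.
\<close>

definition multi_index :: "nat \<Rightarrow> 'n::finite \<Rightarrow> nat" where
  "multi_index = from_nat_into UNIV"

definition monomial :: "nat \<Rightarrow> ('n::finite \<Rightarrow> 'c) \<Rightarrow> 'c::comm_semiring_1" where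
  "monomial n v = (\<Prod>j\<in>UNIV. v j ^ multi_index n j)"

lemma bij_multi_index: "bij (multi_index :: nat \<Rightarrow> 'n::finite \<Rightarrow> nat)"
proof -
  have "inj (\<lambda>k::nat. (\<lambda>_. k) :: 'n \<Rightarrow> nat)" by (auto simp: inj_def fun_eq_iff)
  then have "infinite (range (\<lambda>k::nat. (\<lambda>_. k) :: 'n \<Rightarrow> nat))" by (rule range_inj_infinite)
  then have "infinite (UNIV :: ('n \<Rightarrow> nat) set)" by (rule infinite_super[OF subset_UNIV])
  then show ?thesis unfolding multi_index_def by (intro bij_betw_from_nat_into) simp_all
qed

lemma monomial_mult: "monomial n (\<lambda>j. a j * b j) = monomial n a * monomial n b"
  by (simp add: monomial_def power_mult_distrib prod.distrib)

lemma norm_monomial: "norm (monomial n a) = monomial n (\<lambda>j. norm (a j))"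
  for a :: "'n::finite \<Rightarrow> 'c::real_normed_field"
  unfolding monomial_def norm_power[symmetric] prod_norm ..

lemma monomial_mono: "(\<And>j. 0 \<le> a j \<and> a j \<le> b j) \<Longrightarrow> monomial n a \<le> monomial n b"
  for a :: "'n::finite \<Rightarrow> real"
  unfolding monomial_def by (intro prod_mono conjI power_mono zero_le_power) auto

lemma monomial_nonneg: "(\<And>j. 0 \<le> a j) \<Longrightarrow> 0 \<le> monomial n a"
  for a :: "'n::finite \<Rightarrow> real"
  unfolding monomial_def by (intro prod_nonneg) auto

text \<open>
  A finite set of multi-indices lies in a cube, over which the sum factorises into finite
  one-dimensional geometric sums.
\<close>

lemma monomial_norm_summable:
  fixes a :: "'n::finite \<Rightarrow> real"
  assumes "\<And>j. 0 \<le> a j" "\<And>j. a j < 1"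
  shows "(\<lambda>i. norm (\<Prod>j\<in>UNIV. a j ^ i j)) summable_on (UNIV :: ('n \<Rightarrow> nat) set)"
proof (rule abs_summable_iff_bdd_above[THEN iffD2], rule bdd_aboveI)
  fix s assume "s \<in> sum (\<lambda>i. norm (\<Prod>j\<in>UNIV. a j ^ i j)) ` {F. F \<subseteq> UNIV \<and> finite F}"
  then obtain F :: "('n \<Rightarrow> nat) set" where F: "finite F" "s = (\<Sum>i\<in>F. norm (\<Prod>j\<in>UNIV. a j ^ i j))" by auto
  define m where "m = Max (insert 0 (\<Union>i\<in>F. range i))"
  have "finite (insert 0 (\<Union>i\<in>F. range i))" using F by auto
  then have "F \<subseteq> Pi\<^sub>E UNIV (\<lambda>_. {..m})" unfolding m_def PiE_UNIV_domain by (auto intro!: Max_ge)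
  then have "s \<le> (\<Sum>i\<in>Pi\<^sub>E UNIV (\<lambda>_. {..m}). norm (\<Prod>j\<in>UNIV. a j ^ i j))"
    unfolding F by (intro sum_mono2) (auto intro!: finite_PiE)
  also have "\<dots> = (\<Sum>i\<in>Pi\<^sub>E UNIV (\<lambda>_. {..m}). (\<Prod>j\<in>UNIV. a j ^ i j))"
    using assms by (intro sum.cong refl) (simp add: abs_of_nonneg prod_nonneg)
  also have "\<dots> = (\<Prod>j\<in>UNIV. \<Sum>k\<le>m. a j ^ k)"
    by (subst prod_sum_PiE) auto
  also have "\<dots> \<le> (\<Prod>j\<in>UNIV. 1 / (1 - a j))"
  proof (intro prod_mono conjI sum_nonneg)
    fix j
    have "(\<Sum>k\<le>m. a j ^ k) \<le> (\<Sum>k. a j ^ k)"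
      using assms by (intro sum_le_suminf summable_geometric) auto
    then show "(\<Sum>k\<le>m. a j ^ k) \<le> 1 / (1 - a j)"
      using assms by (simp add: suminf_geometric)
  qed (use assms in auto)
  finally show "s \<le> (\<Prod>j\<in>UNIV. 1 / (1 - a j))" .
qed

lemma monomial_geometric:
  fixes v :: "'n::finite \<Rightarrow> complex"
  assumes v: "\<And>j. norm (v j) < 1"
  shows "summable (\<lambda>n. norm (monomial n v))"
    and "(\<lambda>n. monomial n v) sums (\<Prod>j\<in>UNIV. 1 / (1 - v j))"
proof -
  have abs: "(\<lambda>i. norm (\<Prod>j\<in>UNIV. v j ^ i j)) summable_on (UNIV :: ('n \<Rightarrow> nat) set)"
  proof -
    have "norm (\<Prod>j\<in>UNIV. norm (v j) ^ i j) = norm (\<Prod>j\<in>UNIV. v j ^ i j)" for i :: "'n \<Rightarrow> nat"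
      unfolding norm_power[symmetric] prod_norm by simp
    with monomial_norm_summable[of "\<lambda>j. norm (v j)"] v show ?thesis
      by simp
  qed
  have 1: "(\<lambda>k. norm (v j ^ k)) summable_on UNIV" for j
  proof -
    have "summable (\<lambda>k. norm (v j) ^ k)" using v[of j] by (intro summable_geometric) simp
    then show ?thesis unfolding norm_power
      by (subst summable_on_UNIV_nonneg_real_iff) auto
  qed
  have geo: "(\<Sum>\<^sub>\<infinity>k. v j ^ k) = 1 / (1 - v j)" for j
  proof -
    have "(\<lambda>k. v j ^ k) sums (\<Sum>\<^sub>\<infinity>k. v j ^ k)"
      using has_sum_imp_sums[OF has_sum_infsum[OF abs_summable_summable[OF 1]]] .
    then show ?thesis using geometric_sums[OF v[of j]] by (rule sums_unique2)
  qed
  have "(\<Sum>\<^sub>\<infinity>i\<in>UNIV. \<Prod>j\<in>UNIV. v j ^ i j) = (\<Prod>j\<in>UNIV. 1 / (1 - v j))"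
    using infsum_prod_PiE_abs[of UNIV "\<lambda>j k. v j ^ k" "\<lambda>_. UNIV", OF finite 1]
    unfolding PiE_UNIV_domain geo by simp
  then have "((\<lambda>i. \<Prod>j\<in>UNIV. v j ^ i j) has_sum (\<Prod>j\<in>UNIV. 1 / (1 - v j))) (UNIV :: ('n \<Rightarrow> nat) set)"
    using has_sum_infsum[OF abs_summable_summable[OF abs]] by simp
  then have "((\<lambda>n. monomial n v) has_sum (\<Prod>j\<in>UNIV. 1 / (1 - v j))) UNIV"
    unfolding monomial_def
    by (subst has_sum_reindex_bij_betw[OF bij_multi_index, of "\<lambda>i. \<Prod>j\<in>UNIV. v j ^ i j"])
  then show "(\<lambda>n. monomial n v) sums (\<Prod>j\<in>UNIV. 1 / (1 - v j))" by (rule has_sum_imp_sums)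
  have "(\<lambda>n. norm (monomial n v)) summable_on UNIV"
    unfolding monomial_def
    by (subst summable_on_reindex_bij_betw[OF bij_multi_index, of "\<lambda>i. norm (\<Prod>j\<in>UNIV. v j ^ i j)"]) (rule abs)
  then show "summable (\<lambda>n. norm (monomial n v))" by (rule summable_on_imp_summable)
qed

section \<open>The Newton series in several variables\<close>

text \<open>
  For \<open>t\<close> on the torus, \<^term>\<open>exp (torus_exponent h x t)\<close> is the product over the coordinates of
  \<open>(1 + z\<^sub>j) powr (x\<^sub>j / h)\<close>, where \<open>z\<^sub>j\<close> is the circle point with parameter \<open>t\<^sub>j\<close>.
\<close>

definition torus_exponent :: "real \<Rightarrow> real ^ 'n \<Rightarrow> ('n::finite \<Rightarrow> real) \<Rightarrow> complex" where
  "torus_exponent h v t = (\<Sum>j\<in>UNIV. of_real (v $ j / h) * Ln (1 + circle_point (t j)))"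

text \<open>
  By Cauchy's formula this is the Taylor coefficient of \<open>\<Prod>\<^sub>j (1 + u\<^sub>j) powr (x\<^sub>j / h)\<close> at the multi-index
  \<open>i\<close> with number \<open>n\<close>, that is, the Newton interpolation polynomial \<open>\<Prod>\<^sub>j ((x\<^sub>j / h) gchoose i\<^sub>j)\<close>. The
  integral is the useful form: as a function of \<open>x\<close> it is a superposition of exponentials, and the
  growth in \<open>n\<close> can be read off.
\<close>

definition newton_poly :: "real \<Rightarrow> nat \<Rightarrow> real ^ 'n \<Rightarrow> complex" where
  "newton_poly h n x =
     (\<integral>t. exp (torus_exponent h x t) * monomial n (\<lambda>j. inverse (circle_point (t j))) \<partial>torus)"

lemma linear_torus_exponent: "linear (\<lambda>v. torus_exponent h v t)"
  by (rule linearI)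
     (simp_all add: torus_exponent_def sum.distrib algebra_simps add_divide_distrib sum_distrib_left scaleR_conv_of_real[where 'a=complex])

lemma norm_torus_exponent:
  fixes v :: "real ^ 'n::finite"
  assumes "h > 0"
  shows "norm (torus_exponent h v t) \<le> (real CARD('n) / h) * norm v"
proof -
  have "norm (torus_exponent h v t) \<le> (\<Sum>j\<in>(UNIV::'n set). norm v / h)"
    unfolding torus_exponent_def
  proof (rule sum_norm_le)
    fix j
    have "norm (Ln (1 + circle_point (t j))) \<le> 2 * norm (circle_point (t j))"
      by (rule norm_Ln_le) (simp add: norm_circle_point)
    then have 1: "norm (Ln (1 + circle_point (t j))) \<le> 1" by (simp add: norm_circle_point)
    have "norm (of_real (v $ j / h) * Ln (1 + circle_point (t j))) = \<bar>v $ j\<bar> / h * norm (Ln (1 + circle_point (t j)))"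
      using assms by (simp add: norm_mult norm_divide)
    also have "\<dots> \<le> norm v / h * 1"
      using 1 assms component_le_norm_cart[of v j] by (intro mult_mono divide_right_mono) auto
    finally show "norm (of_real (v $ j / h) * Ln (1 + circle_point (t j))) \<le> norm v / h" by simp
  qed
  then show ?thesis by simp
qed

lemma measurable_torus_exponent [measurable]:
  "torus_exponent h v \<in> borel_measurable (torus :: ('n::finite \<Rightarrow> real) measure)"
  unfolding torus_exponent_def by measurable

lemma measurable_monomial_circle [measurable]:
  "(\<lambda>t. monomial n (\<lambda>j. inverse (circle_point (t j)))) \<in> borel_measurable (torus :: ('n::finite \<Rightarrow> real) measure)"
  unfolding monomial_def by measurable

lemma norm_monomial_circle:
  "norm (monomial n (\<lambda>j::'n::finite. inverse (circle_point (t j)))) = monomial n (\<lambda>j::'n. 4)"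
  by (simp add: norm_monomial norm_inverse norm_circle_point)

lemma norm_exp_torus_exponent:
  fixes x :: "real ^ 'n::finite"
  assumes "h > 0"
  shows "norm (exp (torus_exponent h x t)) \<le> exp (real CARD('n) / h * norm x)"
  using norm_exp[of "torus_exponent h x t"] norm_torus_exponent[OF assms, of x t]
  by (smt (verit) exp_le_cancel_iff)

text \<open>
  The bounds \<open>B n\<close> are constants, so on a probability space they also dominate the integrals.
\<close>

lemma sums_integral_prob_space:
  fixes f :: "nat \<Rightarrow> 't \<Rightarrow> complex"
  assumes "prob_space N" and [measurable]: "\<And>n. f n \<in> borel_measurable N"
    and b: "\<And>n t. t \<in> space N \<Longrightarrow> norm (f n t) \<le> B n" and B: "summable B"
  shows "(\<lambda>n. integral\<^sup>L N (f n)) sums (\<integral>t. (\<Sum>n. f n t) \<partial>N)" "integrable N (\<lambda>t. \<Sum>n. f n t)"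
proof -
  interpret prob_space N by fact
  have i: "integrable N (f n)" for n
    by (rule integrable_const_bound[of _ "B n"]) (use b in auto)
  have a: "AE t in N. summable (\<lambda>n. norm (f n t))"
    using b by (auto intro!: AE_I2 summable_comparison_test[OF _ B])
  have "(\<integral>t. norm (f n t) \<partial>N) \<le> B n" for n
    using integral_mono[of N "\<lambda>t. norm (f n t)" "\<lambda>_. B n"] i b by (simp add: prob_space)
  then have s: "summable (\<lambda>n. \<integral>t. norm (f n t) \<partial>N)"
    by (intro summable_comparison_test[OF _ B]) auto
  show "(\<lambda>n. integral\<^sup>L N (f n)) sums (\<integral>t. (\<Sum>n. f n t) \<partial>N)"
    by (rule sums_integral[OF i a s])
  show "integrable N (\<lambda>t. \<Sum>n. f n t)"
    by (rule integrable_suminf[OF i a s])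
qed

lemma norm_newton_poly:
  fixes x :: "real ^ 'n::finite"
  assumes "h > 0"
  shows "norm (newton_poly h n x) \<le> exp (real CARD('n) / h * norm x) * monomial n (\<lambda>j::'n. 4)"
proof -
  interpret prob_space "torus :: ('n \<Rightarrow> real) measure" by (rule prob_space_torus)
  have b: "norm (exp (torus_exponent h x t) * monomial n (\<lambda>j. inverse (circle_point (t j))))
     \<le> exp (real CARD('n) / h * norm x) * monomial n (\<lambda>j::'n. 4)" for t
    unfolding norm_mult norm_monomial_circle
    by (intro mult_right_mono norm_exp_torus_exponent assms monomial_nonneg) auto
  have "integrable torus (\<lambda>t. exp (torus_exponent h x t) * monomial n (\<lambda>j. inverse (circle_point (t j))))"
    by (rule integrable_const_bound[OF AE_I2[OF b]]) auto
  from norm_integral_le[OF this _ b] show ?thesis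
    unfolding newton_poly_def by (simp add: prob_space)
qed

text \<open>
  The binomial series in several variables. In each coordinate Cauchy's formula writes
  \<open>(1 + u\<^sub>j) powr (x\<^sub>j / h)\<close> as an integral over a circle; the product of these is an integral over the
  torus, and expanding the product of the Cauchy kernels into a geometric series, of ratio at most
  \<open>(1/8) / (1/4)\<close> in each coordinate, gives the terms of the series.
\<close>

lemma newton_expansion:
  fixes u :: "'n::finite \<Rightarrow> complex"
  assumes h: "h > 0" and u: "\<And>j. norm (u j) \<le> 1/8"
  shows "(\<lambda>n. newton_poly h n x * monomial n u) sums (\<Prod>j\<in>UNIV. exp (of_real (x $ j / h) * Ln (1 + u j)))"
proof -
  define f where "f n t = exp (torus_exponent h x t) * monomial n (\<lambda>j. inverse (circle_point (t j))) * monomial n u"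
    for n and t :: "'n \<Rightarrow> real"
  define B where "B n = exp (real CARD('n) / h * norm x) * norm (monomial n (\<lambda>j::'n. 1/2 :: complex))" for n
  have uz: "norm (inverse (circle_point (t j)) * u j) \<le> 1/2" for t j
    using u[of j] by (simp add: norm_mult norm_inverse norm_circle_point)
  have mm: "norm (monomial n (\<lambda>j. inverse (circle_point (t j)) * u j)) \<le> norm (monomial n (\<lambda>j::'n. 1/2 :: complex))" for t n
    unfolding norm_monomial using uz by (intro monomial_mono) auto
  have fB: "norm (f n t) \<le> B n" for n t
    unfolding f_def B_def mult.assoc monomial_mult[symmetric] norm_mult[of "exp _"]
    by (intro mult_mono norm_exp_torus_exponent h mm) auto
  have [measurable]: "f n \<in> borel_measurable torus" for n
    unfolding f_def by measurable
  have "summable B"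
    unfolding B_def by (intro summable_mult monomial_geometric) simp
  note S = sums_integral_prob_space[of torus f B, OF prob_space_torus _ fB this]
  define F where "F j s = exp (of_real (x $ j / h) * Ln (1 + circle_point s)) / (1 - u j / circle_point s)" for j s
  have "(\<Sum>n. f n t) = (\<Prod>j\<in>UNIV. F j (t j))" for t
  proof -
    have "(\<lambda>n. monomial n (\<lambda>j. inverse (circle_point (t j)) * u j))
        sums (\<Prod>j\<in>UNIV. 1 / (1 - inverse (circle_point (t j)) * u j))"
      by (rule monomial_geometric, rule le_less_trans[OF uz[of t]]) simp
    then have "(\<lambda>n. exp (torus_exponent h x t) * monomial n (\<lambda>j. inverse (circle_point (t j)) * u j))
        sums (exp (torus_exponent h x t) * (\<Prod>j\<in>UNIV. 1 / (1 - inverse (circle_point (t j)) * u j)))"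
      by (rule sums_mult)
    then have "(\<Sum>n. f n t) = exp (torus_exponent h x t) * (\<Prod>j\<in>UNIV. 1 / (1 - inverse (circle_point (t j)) * u j))"
      unfolding f_def monomial_mult by (simp add: sums_iff mult.assoc)
    also have "\<dots> = (\<Prod>j\<in>UNIV. F j (t j))"
      unfolding torus_exponent_def exp_sum[OF finite] F_def prod.distrib[symmetric]
      by (intro prod.cong) (auto simp: divide_simps)
    finally show ?thesis .
  qed
  moreover have "(\<integral>t. (\<Prod>j\<in>UNIV. F j (t j)) \<partial>torus) = (\<Prod>j\<in>UNIV. exp (of_real (x $ j / h) * Ln (1 + u j)))"
  proof -
    interpret prob_space unit_interval by (rule prob_space_unit_interval)
    interpret product_sigma_finite "\<lambda>_::'n. unit_interval" by unfold_locales
    have hol: "(\<lambda>w. exp (of_real c * Ln (1 + w))) holomorphic_on ball 0 1" for c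
    proof (intro holomorphic_intros)
      fix z :: complex assume "z \<in> ball 0 1"
      then have "Re (1 + z) > 0" using abs_Re_le_cmod[of z] by simp
      then show "1 + z \<notin> \<real>\<^sub>\<le>\<^sub>0" using complex_nonpos_Reals_iff by force
    qed
    have u4: "norm (u j) < 1/4" for j using u[of j] by simp
    have F1: "integrable unit_interval (F j)"
      and F2: "integral\<^sup>L unit_interval (F j) = exp (of_real (x $ j / h) * Ln (1 + u j))" for j
      unfolding F_def by (rule cauchy_unit_interval[OF hol u4])+
    show ?thesis
      using product_integral_prod[of UNIV F, OF finite F1] unfolding F2 .
  qed
  ultimately have "(\<lambda>n. integral\<^sup>L torus (f n)) sums (\<Prod>j\<in>UNIV. exp (of_real (x $ j / h) * Ln (1 + u j)))"
    using S(1) by simp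
  then show ?thesis
    unfolding f_def newton_poly_def by simp
qed

section \<open>Fields with a spectral density\<close>

definition character :: "'a::real_inner \<Rightarrow> 'a \<Rightarrow> complex" where
  "character y \<xi> = exp (- \<i> * complex_of_real (y \<bullet> \<xi>))"

lemma character_add: "character (x + y) \<xi> = character x \<xi> * character y \<xi>"
  by (simp add: character_def inner_add_left exp_add[symmetric] algebra_simps)

lemma norm_character: "norm (character y \<xi>) = 1"
  by (simp add: character_def)

lemma cnj_character: "cnj (character y \<xi>) = character (- y) \<xi>"
  by (simp add: character_def exp_cnj)

lemma measurable_character [measurable]: "character y \<in> borel_measurable borel"
  for y :: "'a::euclidean_space"
  unfolding character_def by (intro borel_measurable_continuous_onI continuous_intros)

lemma measurable_cnj [measurable]: "cnj \<in> borel_measurable borel"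
  by (intro borel_measurable_continuous_onI continuous_intros)

text \<open>
  Equivalently, sending \<open>X x\<close> to \<open>character x\<close> preserves inner products between the \<open>L\<^sup>2\<close> space of the
  probability measure and that of the measure with density \<open>S\<close>.
\<close>

locale spectral_field = prob_space M
  for M :: "'w measure" +
  fixes X :: "'a::euclidean_space \<Rightarrow> 'w \<Rightarrow> real" and S :: "'a \<Rightarrow> real"
  assumes measurable_field [measurable]: "\<And>x. X x \<in> borel_measurable M"
    and integrable_field_mult: "\<And>x y. integrable M (\<lambda>\<omega>. X x \<omega> * X y \<omega>)"
    and covariance: "\<And>x y. complex_of_real (\<integral>\<omega>. X x \<omega> * X y \<omega> \<partial>M)
      = (\<integral>\<xi>. character (x - y) \<xi> * complex_of_real (S \<xi>) \<partial>lborel)"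
    and S_nonneg: "\<And>\<xi>. S \<xi> \<ge> 0"
    and integrable_S: "integrable lborel S"
begin

text \<open>
  A linear combination of values of the field, paired with the same linear combination of
  characters, its spectral symbol. Building both sides at once avoids any choice of coefficients
  and index sets; the pairing realises the isometry between the span of the field and a subspace of the
  \<open>L\<^sup>2\<close> space of the spectral density.
\<close>

inductive combination :: "('w \<Rightarrow> complex) \<Rightarrow> ('a \<Rightarrow> complex) \<Rightarrow> bool" where
  zero: "combination (\<lambda>_. 0) (\<lambda>_. 0)"
| step: "combination Z p \<Longrightarrow>
    combination (\<lambda>\<omega>. Z \<omega> + a * of_real (X y \<omega>)) (\<lambda>\<xi>. p \<xi> + a * character y \<xi>)"

lemma combination_field: "combination (\<lambda>\<omega>. of_real (X y \<omega>)) (character y)"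
  using step[OF zero, of 1 y] by simp

lemma combination_add:
  assumes "combination Z p" "combination Z' p'"
  shows "combination (\<lambda>\<omega>. Z \<omega> + Z' \<omega>) (\<lambda>\<xi>. p \<xi> + p' \<xi>)"
  using assms(2)
proof induction
  case zero
  then show ?case using assms(1) by simp
next
  case (step Z' p' a y)
  from combination.step[OF step.IH, of a y] show ?case by (simp add: add.assoc)
qed

lemma combination_scale: "combination Z p \<Longrightarrow> combination (\<lambda>\<omega>. c * Z \<omega>) (\<lambda>\<xi>. c * p \<xi>)"
proof (induction rule: combination.induct)
  case zero
  then show ?case using combination.zero by simp
next
  case (step Z p a y)
  from combination.step[OF step.IH, of "c * a" y] show ?case by (simp add: algebra_simps)
qed

lemma combination_diff:
  "combination Z p \<Longrightarrow> combination Z' p' \<Longrightarrow> combination (\<lambda>\<omega>. Z \<omega> - Z' \<omega>) (\<lambda>\<xi>. p \<xi> - p' \<xi>)"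
  using combination_add[OF _ combination_scale[of Z' p' "-1"]] by simp

lemma combination_sum:
  fixes N :: nat
  assumes "\<And>n. combination (Z n) (p n)"
  shows "combination (\<lambda>\<omega>. \<Sum>n<N. Z n \<omega>) (\<lambda>\<xi>. \<Sum>n<N. p n \<xi>)"
  by (induction N) (auto intro: combination.zero combination_add assms)

text \<open>
  Multiplying the symbol by a character translates the field.
\<close>

lemma combination_shift: "combination Z p \<Longrightarrow> \<exists>Z'. combination Z' (\<lambda>\<xi>. p \<xi> * character y \<xi>)"
proof (induction rule: combination.induct)
  case zero
  then show ?case using combination.zero by auto
next
  case (step Z p a x)
  then obtain Z' where "combination Z' (\<lambda>\<xi>. p \<xi> * character y \<xi>)" by blast
  from combination.step[OF this, of a "x + y"] show ?case
    by (auto simp: character_add algebra_simps)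
qed

lemma combination_difference_power:
  "combination Z p \<Longrightarrow> \<exists>Z'. combination Z' (\<lambda>\<xi>. p \<xi> * (character y \<xi> - 1) ^ k)"
proof (induction k arbitrary: Z p)
  case (Suc k)
  obtain Z' where "combination Z' (\<lambda>\<xi>. p \<xi> * character y \<xi>)"
    using combination_shift[OF Suc.prems] by blast
  from combination_diff[OF this Suc.prems] Suc.IH
  obtain Z'' where "combination Z'' (\<lambda>\<xi>. (p \<xi> * character y \<xi> - p \<xi>) * (character y \<xi> - 1) ^ k)"
    by blast
  moreover have "(\<lambda>\<xi>. (p \<xi> * character y \<xi> - p \<xi>) * (character y \<xi> - 1) ^ k)
      = (\<lambda>\<xi>. p \<xi> * (character y \<xi> - 1) ^ Suc k)"
    by (simp add: algebra_simps)
  ultimately show ?case by auto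
qed auto

text \<open>
  The products on the right are the symbols of iterated finite differences of the field at the
  origin. These differences are the random coefficients of the Newton series.
\<close>

lemma combination_difference_prod:
  assumes "finite J"
  shows "\<exists>Z. combination Z (\<lambda>\<xi>. \<Prod>j\<in>J. (character (y j) \<xi> - 1) ^ k j)"
  using assms
proof induction
  case empty
  have "character (0::'a) = (\<lambda>\<xi>. 1)" by (simp add: character_def fun_eq_iff)
  then have "combination (\<lambda>\<omega>. of_real (X 0 \<omega>)) (\<lambda>\<xi>. 1)"
    using combination_field[of 0] by simp
  then show ?case by auto
next
  case (insert j J)
  then obtain Z where "combination Z (\<lambda>\<xi>. \<Prod>j\<in>J. (character (y j) \<xi> - 1) ^ k j)" by blast
  from combination_difference_power[OF this, of "y j" "k j"] insert show ?case
    by (simp add: mult.commute)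
qed

lemma combination_measurable: "combination Z p \<Longrightarrow> Z \<in> borel_measurable M"
  by (induction rule: combination.induct) auto

lemma combination_symbol:
  "combination Z p \<Longrightarrow> p \<in> borel_measurable borel \<and> (\<exists>B. \<forall>\<xi>. norm (p \<xi>) \<le> B)"
proof (induction rule: combination.induct)
  case zero
  show ?case by auto
next
  case (step Z p a y)
  then obtain B where B: "norm (p \<xi>) \<le> B" for \<xi> by blast
  have "norm (p \<xi> + a * character y \<xi>) \<le> B + norm a" for \<xi>
    using norm_triangle_ineq[of "p \<xi>" "a * character y \<xi>"] B[of \<xi>] by (simp add: norm_mult norm_character)
  then show ?case using step by auto
qed

lemma integrable_symbol:
  assumes "combination Z p" "g \<in> borel_measurable borel" "\<And>\<xi>. norm (g \<xi>) \<le> C"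
  shows "integrable lborel (\<lambda>\<xi>. p \<xi> * g \<xi> * complex_of_real (S \<xi>))"
proof -
  obtain B where pm [measurable]: "p \<in> borel_measurable borel" and B: "norm (p \<xi>) \<le> B" for \<xi>
    using combination_symbol[OF assms(1)] by blast
  have [measurable]: "g \<in> borel_measurable borel" by fact
  have "norm (p \<xi> * g \<xi>) \<le> B * C" for \<xi>
    unfolding norm_mult using order_trans[OF norm_ge_zero B[of \<xi>]] by (intro mult_mono B assms(3)) auto
  then show ?thesis
    by (intro integrable_bounded_mult) (use integrable_S in auto)
qed

lemma combination_field_inner:
  assumes "combination Z p"
  shows "integrable M (\<lambda>\<omega>. Z \<omega> * of_real (X y \<omega>))"
    and "(\<integral>\<omega>. Z \<omega> * of_real (X y \<omega>) \<partial>M) = (\<integral>\<xi>. p \<xi> * cnj (character y \<xi>) * complex_of_real (S \<xi>) \<partial>lborel)"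
proof -
  have "integrable M (\<lambda>\<omega>. Z \<omega> * of_real (X y \<omega>)) \<and>
    (\<integral>\<omega>. Z \<omega> * of_real (X y \<omega>) \<partial>M) = (\<integral>\<xi>. p \<xi> * cnj (character y \<xi>) * complex_of_real (S \<xi>) \<partial>lborel)"
    using assms
  proof induction
    case zero
    show ?case by simp
  next
    case (step Z p a x)
    have i: "integrable M (\<lambda>\<omega>. a * of_real (X x \<omega> * X y \<omega>))"
      by (intro Bochner_Integration.integrable_mult_right impI integrable_of_real integrable_field_mult)
    have "(\<integral>\<omega>. a * of_real (X x \<omega> * X y \<omega>) \<partial>M)
        = a * (\<integral>\<xi>. character (x - y) \<xi> * complex_of_real (S \<xi>) \<partial>lborel)"
      unfolding covariance[symmetric] by (simp del: of_real_mult)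
    also have "\<dots> = (\<integral>\<xi>. a * character x \<xi> * cnj (character y \<xi>) * complex_of_real (S \<xi>) \<partial>lborel)"
      using character_add[of x "- y"] by (simp add: cnj_character mult.assoc)
    finally have e: "(\<integral>\<omega>. a * of_real (X x \<omega> * X y \<omega>) \<partial>M) = \<dots>" .
    have s1: "integrable lborel (\<lambda>\<xi>. p \<xi> * cnj (character y \<xi>) * complex_of_real (S \<xi>))"
      unfolding cnj_character by (rule integrable_symbol[OF step.hyps, of _ 1]) (auto simp: norm_character)
    have s2: "integrable lborel (\<lambda>\<xi>. (a * character x \<xi>) * cnj (character y \<xi>) * complex_of_real (S \<xi>))"
      unfolding cnj_character
      by (rule integrable_symbol[OF combination_scale[OF combination_field], of _ 1]) (auto simp: norm_character)
    have "(\<lambda>\<omega>. (Z \<omega> + a * of_real (X x \<omega>)) * of_real (X y \<omega>))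
        = (\<lambda>\<omega>. Z \<omega> * of_real (X y \<omega>) + a * of_real (X x \<omega> * X y \<omega>))"
      by (simp add: algebra_simps)
    moreover have "(\<lambda>\<xi>. (p \<xi> + a * character x \<xi>) * cnj (character y \<xi>) * complex_of_real (S \<xi>))
        = (\<lambda>\<xi>. p \<xi> * cnj (character y \<xi>) * complex_of_real (S \<xi>)
          + a * character x \<xi> * cnj (character y \<xi>) * complex_of_real (S \<xi>))"
      by (simp add: algebra_simps)
    ultimately show ?case
      using i e s1 s2 step.IH by (simp del: of_real_mult)
  qed
  then show "integrable M (\<lambda>\<omega>. Z \<omega> * of_real (X y \<omega>))"
    "(\<integral>\<omega>. Z \<omega> * of_real (X y \<omega>) \<partial>M) = (\<integral>\<xi>. p \<xi> * cnj (character y \<xi>) * complex_of_real (S \<xi>) \<partial>lborel)"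
    by auto
qed

text \<open>
  Both sides are sesquilinear, so induction on each argument reduces this to two values of the field,
  where it is the covariance formula.
\<close>

lemma combination_isometry:
  assumes Z: "combination Z p" and Z': "combination Z' p'"
  shows "integrable M (\<lambda>\<omega>. Z \<omega> * cnj (Z' \<omega>)) \<and>
    (\<integral>\<omega>. Z \<omega> * cnj (Z' \<omega>) \<partial>M) = (\<integral>\<xi>. p \<xi> * cnj (p' \<xi>) * complex_of_real (S \<xi>) \<partial>lborel)"
  using Z'
proof induction
  case zero
  show ?case by simp
next
  case (step Z' p' a y)
  obtain B where pm [measurable]: "p' \<in> borel_measurable borel" and B: "norm (p' \<xi>) \<le> B" for \<xi>
    using combination_symbol[OF step.hyps] by blast
  have s1: "integrable lborel (\<lambda>\<xi>. p \<xi> * cnj (p' \<xi>) * complex_of_real (S \<xi>))"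
    by (rule integrable_symbol[OF Z, of _ B]) (measurable, simp add: B)
  have s2: "integrable lborel (\<lambda>\<xi>. p \<xi> * cnj (character y \<xi>) * complex_of_real (S \<xi>))"
    unfolding cnj_character by (rule integrable_symbol[OF Z, of _ 1]) (auto simp: norm_character)
  have "(\<lambda>\<omega>. Z \<omega> * cnj (Z' \<omega> + a * of_real (X y \<omega>)))
      = (\<lambda>\<omega>. Z \<omega> * cnj (Z' \<omega>) + cnj a * (Z \<omega> * of_real (X y \<omega>)))"
    by (simp add: algebra_simps)
  moreover have "(\<lambda>\<xi>. p \<xi> * cnj (p' \<xi> + a * character y \<xi>) * complex_of_real (S \<xi>))
      = (\<lambda>\<xi>. p \<xi> * cnj (p' \<xi>) * complex_of_real (S \<xi>)
        + cnj a * (p \<xi> * cnj (character y \<xi>) * complex_of_real (S \<xi>)))"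
    by (simp add: algebra_simps)
  ultimately show ?case
    using step.IH s1 s2 combination_field_inner[OF Z, of y] by simp
qed

lemma combination_second_moment:
  assumes Z: "combination Z p" and B: "\<And>\<xi>. S \<xi> \<noteq> 0 \<Longrightarrow> norm (p \<xi>) \<le> B"
  shows "integrable M (\<lambda>\<omega>. (norm (Z \<omega>))\<^sup>2)"
    and "(\<integral>\<omega>. (norm (Z \<omega>))\<^sup>2 \<partial>M) \<le> B\<^sup>2 * integral\<^sup>L lborel S"
proof -
  have e: "Z \<omega> * cnj (Z \<omega>) = complex_of_real ((norm (Z \<omega>))\<^sup>2)" for \<omega>
    using complex_norm_square[of "Z \<omega>"] by simp
  have "integrable M (\<lambda>\<omega>. Re (Z \<omega> * cnj (Z \<omega>)))"
    using combination_isometry[OF Z Z] by (intro integrable_Re) auto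
  then show i: "integrable M (\<lambda>\<omega>. (norm (Z \<omega>))\<^sup>2)"
    unfolding e by simp
  have "complex_of_real (\<integral>\<omega>. (norm (Z \<omega>))\<^sup>2 \<partial>M) = (\<integral>\<xi>. p \<xi> * cnj (p \<xi>) * complex_of_real (S \<xi>) \<partial>lborel)"
    using combination_isometry[OF Z Z] unfolding e by (simp del: of_real_power)
  then have "(\<integral>\<omega>. (norm (Z \<omega>))\<^sup>2 \<partial>M) \<le> norm (\<integral>\<xi>. p \<xi> * cnj (p \<xi>) * complex_of_real (S \<xi>) \<partial>lborel)"
    by (metis abs_ge_self norm_of_real)
  also have "\<dots> \<le> (\<integral>\<xi>. B\<^sup>2 * S \<xi> \<partial>lborel)"
  proof (rule norm_integral_le)
    obtain C where pm [measurable]: "p \<in> borel_measurable borel" and C: "norm (p \<xi>) \<le> C" for \<xi>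
      using combination_symbol[OF Z] by blast
    show "integrable lborel (\<lambda>\<xi>. p \<xi> * cnj (p \<xi>) * complex_of_real (S \<xi>))"
      by (rule integrable_symbol[OF Z, of _ C]) (measurable, simp add: C)
    show "norm (p \<xi> * cnj (p \<xi>) * complex_of_real (S \<xi>)) \<le> B\<^sup>2 * S \<xi>" for \<xi>
    proof (cases "S \<xi> = 0")
      case False
      have "norm (p \<xi> * cnj (p \<xi>) * complex_of_real (S \<xi>)) = (norm (p \<xi>))\<^sup>2 * S \<xi>"
        using S_nonneg[of \<xi>] by (simp add: norm_mult power2_eq_square)
      also have "\<dots> \<le> B\<^sup>2 * S \<xi>"
        using B[OF False] S_nonneg[of \<xi>] by (intro mult_right_mono power_mono) auto
      finally show ?thesis .
    qed simp
  qed (use integrable_S in simp)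
  finally show "(\<integral>\<omega>. (norm (Z \<omega>))\<^sup>2 \<partial>M) \<le> B\<^sup>2 * integral\<^sup>L lborel S" by simp
qed

text \<open>
  Take expectations in \<open>z \<le> B + z\<^sup>2 / B\<close>: the second moment is of order \<open>B\<^sup>2\<close>, so the right-hand
  side is of order \<open>B\<close>.
\<close>

lemma combination_first_moment:
  assumes Z: "combination Z p" and B: "\<And>\<xi>. S \<xi> \<noteq> 0 \<Longrightarrow> norm (p \<xi>) \<le> B" and "B > 0"
  shows "integrable M (\<lambda>\<omega>. norm (Z \<omega>))"
    and "(\<integral>\<omega>. norm (Z \<omega>) \<partial>M) \<le> B * (1 + integral\<^sup>L lborel S)"
proof -
  note m = combination_second_moment[OF Z B]
  have [measurable]: "Z \<in> borel_measurable M" by (rule combination_measurable[OF Z])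
  have le: "norm (Z \<omega>) \<le> B + (norm (Z \<omega>))\<^sup>2 / B" for \<omega>
  proof (cases "norm (Z \<omega>) \<le> B")
    case False
    then have "norm (Z \<omega>) * B \<le> (norm (Z \<omega>))\<^sup>2" by (simp add: power2_eq_square mult_left_mono)
    then have "norm (Z \<omega>) \<le> (norm (Z \<omega>))\<^sup>2 / B" using \<open>B > 0\<close> by (simp add: pos_le_divide_eq)
    then show ?thesis using \<open>B > 0\<close> by linarith
  qed (use \<open>B > 0\<close> in \<open>simp add: add_increasing2\<close>)
  have i: "integrable M (\<lambda>\<omega>. B + (norm (Z \<omega>))\<^sup>2 / B)"
    using m(1) by simp
  show 1: "integrable M (\<lambda>\<omega>. norm (Z \<omega>))"
    by (rule Bochner_Integration.integrable_bound[OF i]) (use le \<open>B > 0\<close> in \<open>auto intro: order_trans\<close>)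
  have "(\<integral>\<omega>. norm (Z \<omega>) \<partial>M) \<le> (\<integral>\<omega>. B + (norm (Z \<omega>))\<^sup>2 / B \<partial>M)"
    by (rule integral_mono[OF 1 i le])
  also have "\<dots> = B + (\<integral>\<omega>. (norm (Z \<omega>))\<^sup>2 \<partial>M) / B"
    using m(1) by (simp add: prob_space)
  also have "\<dots> \<le> B + (B\<^sup>2 * integral\<^sup>L lborel S) / B"
    using m(2) \<open>B > 0\<close> by (intro add_left_mono divide_right_mono) auto
  also have "\<dots> = B * (1 + integral\<^sup>L lborel S)"
    using \<open>B > 0\<close> by (simp add: power2_eq_square algebra_simps)
  finally show "(\<integral>\<omega>. norm (Z \<omega>) \<partial>M) \<le> B * (1 + integral\<^sup>L lborel S)" .
qed

end

text \<open>
  Fatou's lemma applied to the squared norms identifies the two limits.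
\<close>

lemma AE_eq_0_of_L2_limit:
  fixes f :: "nat \<Rightarrow> 'w \<Rightarrow> complex"
  assumes [measurable]: "\<And>n. f n \<in> borel_measurable M"
    and i: "\<And>n. integrable M (\<lambda>\<omega>. (norm (f n \<omega>))\<^sup>2)"
    and l: "AE \<omega> in M. (\<lambda>n. f n \<omega>) \<longlonglongrightarrow> l \<omega>"
    and L2: "(\<lambda>n. \<integral>\<omega>. (norm (f n \<omega>))\<^sup>2 \<partial>M) \<longlonglongrightarrow> 0"
  shows "AE \<omega> in M. l \<omega> = 0"
proof -
  have "(\<integral>\<^sup>+\<omega>. liminf (\<lambda>n. ennreal ((norm (f n \<omega>))\<^sup>2)) \<partial>M)
      \<le> liminf (\<lambda>n. \<integral>\<^sup>+\<omega>. ennreal ((norm (f n \<omega>))\<^sup>2) \<partial>M)"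
    by (rule nn_integral_liminf) measurable
  also have "\<dots> = liminf (\<lambda>n. ennreal (\<integral>\<omega>. (norm (f n \<omega>))\<^sup>2 \<partial>M))"
    using i by (subst nn_integral_eq_integral) auto
  also have "\<dots> = 0"
    using tendsto_ennrealI[OF L2] by (simp add: lim_imp_Liminf)
  finally have "(\<integral>\<^sup>+\<omega>. liminf (\<lambda>n. ennreal ((norm (f n \<omega>))\<^sup>2)) \<partial>M) = 0" by simp
  then have "AE \<omega> in M. liminf (\<lambda>n. ennreal ((norm (f n \<omega>))\<^sup>2)) = 0"
    by (subst (asm) nn_integral_0_iff_AE) auto
  with l show ?thesis
  proof eventually_elim
    case (elim \<omega>)
    have "(\<lambda>n. ennreal ((norm (f n \<omega>))\<^sup>2)) \<longlonglongrightarrow> ennreal ((norm (l \<omega>))\<^sup>2)"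
      using elim(1) by (intro tendsto_ennrealI tendsto_intros)
    then have "liminf (\<lambda>n. ennreal ((norm (f n \<omega>))\<^sup>2)) = ennreal ((norm (l \<omega>))\<^sup>2)"
      by (intro lim_imp_Liminf) auto
    with elim(2) show ?case by simp
  qed
qed

section \<open>Band-limited fields have smooth modifications\<close>

text \<open>
  With step \<open>1 / (8 * \<kappa>)\<close> the differences \<open>u\<^sub>j = exp (- \<i> * h * \<xi>\<^sub>j) - 1\<close> are at most \<open>1/8\<close> in modulus on the
  whole band, and the principal logarithm recovers the exponent. Here the boundedness of the band enters.
\<close>

lemma character_difference_small:
  assumes "\<kappa> > 0" "norm \<xi> \<le> \<kappa>"
  defines "h \<equiv> 1 / (8 * \<kappa>)"
  shows "norm (character (h *\<^sub>R axis j 1) \<xi> - 1) \<le> 1/8"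
    and "Ln (character (h *\<^sub>R axis j 1) \<xi>) = - \<i> * complex_of_real (h * \<xi> $ j)"
proof -
  have c: "character (h *\<^sub>R axis j 1) \<xi> = exp (\<i> * complex_of_real (- (h * \<xi> $ j)))"
    by (simp add: character_def inner_axis')
  have "\<bar>\<xi> $ j\<bar> \<le> \<kappa>" using component_le_norm_cart[of \<xi> j] assms by linarith
  then have b: "\<bar>h * \<xi> $ j\<bar> \<le> 1/8"
    using \<open>\<kappa> > 0\<close> by (simp add: h_def abs_mult field_simps)
  have "norm (character (h *\<^sub>R axis j 1) \<xi> - 1) \<le> \<bar>h * \<xi> $ j\<bar>"
    unfolding c dist_exp_i_1 using abs_sin_x_le_abs_x[of "- (h * \<xi> $ j) / 2"] by simp
  with b show "norm (character (h *\<^sub>R axis j 1) \<xi> - 1) \<le> 1/8" by simp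
  have "Ln (exp (\<i> * complex_of_real (- (h * \<xi> $ j)))) = \<i> * complex_of_real (- (h * \<xi> $ j))"
    using b pi_gt3 by (intro Ln_exp) auto
  then show "Ln (character (h *\<^sub>R axis j 1) \<xi>) = - \<i> * complex_of_real (h * \<xi> $ j)"
    unfolding c by simp
qed

lemma character_newton_expansion:
  assumes "\<kappa> > 0" "norm \<xi> \<le> \<kappa>"
  defines "h \<equiv> 1 / (8 * \<kappa>)"
  shows "(\<lambda>n. newton_poly h n x * monomial n (\<lambda>j. character (h *\<^sub>R axis j 1) \<xi> - 1)) sums character x \<xi>"
proof -
  have h: "h > 0" using assms by simp
  have "(\<Prod>j\<in>UNIV. exp (of_real (x $ j / h) * Ln (1 + (character (h *\<^sub>R axis j 1) \<xi> - 1))))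
      = (\<Prod>j\<in>UNIV. exp (- \<i> * of_real (x $ j * \<xi> $ j)))"
    using h by (simp add: character_difference_small(2)[OF assms(1,2), folded h_def] mult_ac)
  also have "\<dots> = character x \<xi>"
    unfolding character_def inner_vec_def by (simp add: exp_sum[symmetric] sum_distrib_left sum_negf)
  finally show ?thesis
    using newton_expansion[OF h, of "\<lambda>j. character (h *\<^sub>R axis j 1) \<xi> - 1" x]
      character_difference_small(1)[OF assms(1,2), folded h_def] by simp
qed

lemma summable_monomial_half: "summable (\<lambda>n. monomial n (\<lambda>j::'n::finite. 1/2 :: real))"
proof -
  have "summable (\<lambda>n. norm (monomial n (\<lambda>j::'n. 1/2 :: complex)))"
    by (rule monomial_geometric) simp
  then show ?thesis unfolding norm_monomial by simp
qed

lemma monomial_4_times_eighth: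
  "monomial n (\<lambda>j::'n::finite. 4 :: real) * monomial n (\<lambda>j::'n. 1/8) = monomial n (\<lambda>j::'n. 1/2)"
  unfolding monomial_mult[symmetric] by simp

text \<open>
  The torus has finite measure and the reciprocal monomials on it have modulus \<open>4\<^sup>|\<^sup>i\<^sup>|\<close>. Under the
  summability assumption the series may be summed inside the integral that defines the Newton
  polynomials, so its sum is a superposition of exponentials with an integrable weight.
\<close>

lemma smooth_newton_series:
  fixes z :: "nat \<Rightarrow> complex"
  assumes h: "h > 0" and z: "summable (\<lambda>n. norm (z n) * monomial n (\<lambda>j::'n::finite. 4))"
  shows "smooth (\<lambda>x :: real ^ 'n. Re (\<Sum>n. z n * newton_poly h n x))"
    and "summable (\<lambda>n. z n * newton_poly h n (x :: real ^ 'n))"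
proof -
  define q where "q n t = z n * monomial n (\<lambda>j::'n. inverse (circle_point (t j)))" for n t
  have [measurable]: "q n \<in> borel_measurable torus" for n unfolding q_def by measurable
  have qB: "norm (q n t) \<le> norm (z n) * monomial n (\<lambda>j::'n. 4)" for n t
    unfolding q_def norm_mult norm_monomial_circle by simp
  note Q = sums_integral_prob_space[of torus q, OF prob_space_torus _ qB z]
  have S: "(\<lambda>n. z n * newton_poly h n x) sums (\<integral>t. exp (torus_exponent h x t) * (\<Sum>n. q n t) \<partial>torus)"
    for x :: "real ^ 'n"
  proof -
    have b: "norm (exp (torus_exponent h x t) * q n t)
        \<le> exp (real CARD('n) / h * norm x) * (norm (z n) * monomial n (\<lambda>j::'n. 4))" for n t
      unfolding norm_mult by (intro mult_mono norm_exp_torus_exponent h qB) auto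
    have "(\<lambda>n. \<integral>t. exp (torus_exponent h x t) * q n t \<partial>torus)
        sums (\<integral>t. (\<Sum>n. exp (torus_exponent h x t) * q n t) \<partial>torus)"
      by (rule sums_integral_prob_space(1)[OF prob_space_torus _ b summable_mult[OF z]]) measurable
    moreover have "(\<integral>t. exp (torus_exponent h x t) * q n t \<partial>torus) = z n * newton_poly h n x" for n
      unfolding q_def newton_poly_def by (subst mult.left_commute) simp
    moreover have "(\<Sum>n. exp (torus_exponent h x t) * q n t) = exp (torus_exponent h x t) * (\<Sum>n. q n t)" for t
      by (intro suminf_mult summable_comparison_test[OF _ z]) (use qB in auto)
    ultimately show ?thesis by simp
  qed
  show "summable (\<lambda>n. z n * newton_poly h n x)" using S[of x] by (simp add: sums_iff)
  have "smooth (\<lambda>x :: real ^ 'n. Re (\<integral>t. exp (torus_exponent h x t) * (\<Sum>n. q n t) \<partial>torus))"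
    by (rule smooth_exp_superposition[OF linear_torus_exponent norm_torus_exponent[OF h] _ Q(2)]) measurable
  then show "smooth (\<lambda>x :: real ^ 'n. Re (\<Sum>n. z n * newton_poly h n x))"
    using S by (simp add: sums_iff)
qed

lemma (in prob_space) AE_summable_of_expectation_summable:
  fixes f :: "nat \<Rightarrow> 'a \<Rightarrow> real"
  assumes i: "\<And>n. integrable M (f n)" and nn: "\<And>n \<omega>. f n \<omega> \<ge> 0"
    and b: "\<And>n. expectation (f n) \<le> B n" and B: "summable B"
  shows "AE \<omega> in M. summable (\<lambda>n. f n \<omega>)"
proof -
  have [measurable]: "f n \<in> borel_measurable M" for n using i by blast
  have B0: "0 \<le> B n" for n using order_trans[OF Bochner_Integration.integral_nonneg b[of n]] nn by simp
  have "(\<integral>\<^sup>+\<omega>. (\<Sum>n. ennreal (f n \<omega>)) \<partial>M) = (\<Sum>n. \<integral>\<^sup>+\<omega>. ennreal (f n \<omega>) \<partial>M)"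
    by (rule nn_integral_suminf) measurable
  also have "\<dots> = (\<Sum>n. ennreal (expectation (f n)))"
    using i nn by (subst nn_integral_eq_integral) auto
  also have "\<dots> \<le> (\<Sum>n. ennreal (B n))"
    by (intro suminf_le) (auto intro: ennreal_leI b)
  also have "\<dots> = ennreal (\<Sum>n. B n)" by (rule suminf_ennreal2[OF B0 B])
  also have "\<dots> < \<infinity>" by simp
  finally have "AE \<omega> in M. (\<Sum>n. ennreal (f n \<omega>)) \<noteq> \<infinity>"
    by (intro nn_integral_PInf_AE) auto
  then show ?thesis
  proof eventually_elim
    case (elim \<omega>)
    then show ?case by (intro summable_suminf_not_top) (auto simp: nn)
  qed
qed

text \<open>
  Let \<open>Z n\<close> be the iterated finite difference of the field at the origin with multi-index number
  \<open>n\<close>. Its symbol is at most \<open>r n = 8\<^sup>-\<^sup>|\<^sup>i\<^sup>|\<close> on the band, so its expected modulus is of that order, and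
  almost surely \<open>\<Sum>n. norm (Z n) * 4\<^sup>|\<^sup>i\<^sup>|\<close> converges, because \<open>\<Sum>n. (4/8)\<^sup>|\<^sup>i\<^sup>|\<close> does.
  The modification is the Newton series
  with these coefficients. It agrees with the field because the same series of symbols converges
  to the character uniformly on the band, hence the partial sums converge in mean square.
\<close>

lemma spectral_field_smooth_modification:
  fixes X :: "real ^ 'n::finite \<Rightarrow> 'w \<Rightarrow> real"
  assumes "spectral_field M X S" and k: "\<kappa> > 0" and supp: "\<And>\<xi>. S \<xi> \<noteq> 0 \<Longrightarrow> norm \<xi> \<le> \<kappa>"
  shows "\<exists>Y. modification M Y X \<and> (AE \<omega> in M. smooth (\<lambda>x. Y x \<omega>))"
proof -
  interpret spectral_field M X S by fact
  define h where "h = 1 / (8 * \<kappa>)"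
  have h: "h > 0" using k by (simp add: h_def)
  define p where "p n \<xi> = monomial n (\<lambda>j. character (h *\<^sub>R axis j 1 :: real ^ 'n) \<xi> - 1)" for n and \<xi> :: "real ^ 'n"
  define r where "r n = monomial n (\<lambda>j::'n. 1/8 :: real)" for n
  have r0: "r n > 0" for n unfolding r_def monomial_def by (intro prod_pos) simp
  have p: "norm (p n \<xi>) \<le> r n" if "norm \<xi> \<le> \<kappa>" for n \<xi>
    unfolding p_def r_def norm_monomial
    using character_difference_small(1)[OF k that] by (intro monomial_mono) (auto simp: h_def)
  have "\<exists>Z. combination Z (p n)" for n
    unfolding p_def monomial_def by (rule combination_difference_prod) simp
  then obtain Z where Z: "combination (Z n) (p n)" for n by metis
  have [measurable]: "Z n \<in> borel_measurable M" for n by (rule combination_measurable[OF Z])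
  note Z1 = combination_first_moment[OF Z p[OF supp] r0]
  have good: "AE \<omega> in M. summable (\<lambda>n. norm (Z n \<omega>) * monomial n (\<lambda>j::'n. 4))"
  proof (rule AE_summable_of_expectation_summable)
    show "integrable M (\<lambda>\<omega>. norm (Z n \<omega>) * monomial n (\<lambda>j::'n. 4))" for n
      using Z1(1) by simp
    show "expectation (\<lambda>\<omega>. norm (Z n \<omega>) * monomial n (\<lambda>j::'n. 4))
        \<le> (1 + integral\<^sup>L lborel S) * monomial n (\<lambda>j::'n. 1/2)" for n
    proof -
      have "expectation (\<lambda>\<omega>. norm (Z n \<omega>) * monomial n (\<lambda>j::'n. 4))
          = expectation (\<lambda>\<omega>. norm (Z n \<omega>)) * monomial n (\<lambda>j::'n. 4)"
        using Z1(1) by simp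
      also have "\<dots> \<le> r n * (1 + integral\<^sup>L lborel S) * monomial n (\<lambda>j::'n. 4)"
        by (intro mult_right_mono Z1(2) monomial_nonneg) auto
      also have "\<dots> = (1 + integral\<^sup>L lborel S) * monomial n (\<lambda>j::'n. 1/2)"
        using monomial_4_times_eighth[where 'n='n, of n] by (simp add: r_def mult_ac)
      finally show ?thesis .
    qed
    show "summable (\<lambda>n. (1 + integral\<^sup>L lborel S) * monomial n (\<lambda>j::'n. 1/2))"
      by (intro summable_mult summable_monomial_half)
  qed (auto intro!: mult_nonneg_nonneg monomial_nonneg)
  define Y where "Y x \<omega> = Re (\<Sum>n. Z n \<omega> * newton_poly h n x)" for x :: "real ^ 'n" and \<omega>
  have Ym: "Y x \<in> borel_measurable M" for x unfolding Y_def by measurable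
  have "AE \<omega> in M. Y x \<omega> = X x \<omega>" for x
  proof -
    define R where "R N \<omega> = of_real (X x \<omega>) - (\<Sum>n<N. newton_poly h n x * Z n \<omega>)" for N \<omega>
    have R: "combination (R N) (\<lambda>\<xi>. character x \<xi> - (\<Sum>n<N. newton_poly h n x * p n \<xi>))" for N
      unfolding R_def by (intro combination_diff combination_field combination_sum combination_scale Z)
    define c where "c = exp (real CARD('n) / h * norm x)"
    \<comment> \<open>The Newton polynomials grow like \<open>4\<^sup>|\<^sup>i\<^sup>|\<close> and the symbols decay like \<open>8\<^sup>-\<^sup>|\<^sup>i\<^sup>|\<close>: the error is a tail of a convergent series.\<close>
    define \<epsilon> where "\<epsilon> N = c * (\<Sum>n. monomial (n + N) (\<lambda>j::'n. 1/2 :: real))" for N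
    have \<epsilon>: "norm (character x \<xi> - (\<Sum>n<N. newton_poly h n x * p n \<xi>)) \<le> \<epsilon> N" if "S \<xi> \<noteq> 0" for N \<xi>
    proof -
      note \<xi> = supp[OF that]
      have s: "(\<lambda>n. newton_poly h n x * p n \<xi>) sums character x \<xi>"
        unfolding p_def h_def by (rule character_newton_expansion[OF k \<xi>])
      have b: "norm (newton_poly h n x * p n \<xi>) \<le> c * monomial n (\<lambda>j::'n. 1/2)" for n
      proof -
        have "norm (newton_poly h n x * p n \<xi>) \<le> (c * monomial n (\<lambda>j::'n. 4)) * r n"
          unfolding norm_mult c_def using r0[of n]
          by (intro mult_mono norm_newton_poly[OF h] p \<xi>) (auto intro!: monomial_nonneg mult_nonneg_nonneg)
        then show ?thesis
          using monomial_4_times_eighth[where 'n='n, of n] by (simp add: r_def mult.assoc)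
      qed
      have sh: "summable (\<lambda>n. c * monomial (n + N) (\<lambda>j::'n. 1/2 :: real))"
        using summable_ignore_initial_segment[OF summable_monomial_half, of N] by (rule summable_mult)
      have "character x \<xi> - (\<Sum>n<N. newton_poly h n x * p n \<xi>) = (\<Sum>n. newton_poly h (n + N) x * p (n + N) \<xi>)"
        using suminf_minus_initial_segment[OF sums_summable[OF s], of N] s by (simp add: sums_iff)
      also have "norm \<dots> \<le> (\<Sum>n. c * monomial (n + N) (\<lambda>j::'n. 1/2))"
        by (rule norm_suminf_le[OF b sh])
      also have "\<dots> = \<epsilon> N"
        unfolding \<epsilon>_def by (rule suminf_mult[OF summable_ignore_initial_segment[OF summable_monomial_half]])
      finally show ?thesis .
    qed
    note R2 = combination_second_moment[OF R \<epsilon>]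
    have "\<epsilon> \<longlonglongrightarrow> c * 0"
      unfolding \<epsilon>_def by (intro tendsto_intros suminf_exist_split2 summable_monomial_half)
    then have "(\<lambda>N. (\<epsilon> N)\<^sup>2 * integral\<^sup>L lborel S) \<longlonglongrightarrow> (c * 0)\<^sup>2 * integral\<^sup>L lborel S"
      by (intro tendsto_intros)
    then have \<epsilon>_lim: "(\<lambda>N. (\<epsilon> N)\<^sup>2 * integral\<^sup>L lborel S) \<longlonglongrightarrow> 0" by simp
    have lim: "(\<lambda>N. expectation (\<lambda>\<omega>. (norm (R N \<omega>))\<^sup>2)) \<longlonglongrightarrow> 0"
    proof (rule tendsto_sandwich[OF _ _ tendsto_const \<epsilon>_lim])
      show "\<forall>\<^sub>F N in sequentially. 0 \<le> expectation (\<lambda>\<omega>. (norm (R N \<omega>))\<^sup>2)" by simp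
      show "\<forall>\<^sub>F N in sequentially. expectation (\<lambda>\<omega>. (norm (R N \<omega>))\<^sup>2) \<le> (\<epsilon> N)\<^sup>2 * integral\<^sup>L lborel S"
        using R2(2) by simp
    qed
    have "AE \<omega> in M. of_real (X x \<omega>) - (\<Sum>n. newton_poly h n x * Z n \<omega>) = 0"
    proof (rule AE_eq_0_of_L2_limit[OF combination_measurable[OF R] R2(1) _ lim])
      show "AE \<omega> in M. (\<lambda>N. R N \<omega>) \<longlonglongrightarrow> of_real (X x \<omega>) - (\<Sum>n. newton_poly h n x * Z n \<omega>)"
        using good
      proof eventually_elim
        case (elim \<omega>)
        have "summable (\<lambda>n. newton_poly h n x * Z n \<omega>)"
          using smooth_newton_series(2)[OF h elim, of x] by (simp add: mult.commute)
        then show ?case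
          unfolding R_def by (intro tendsto_intros summable_LIMSEQ)
      qed
    qed
    then show ?thesis
    proof eventually_elim
      case (elim \<omega>)
      then have "(\<Sum>n. Z n \<omega> * newton_poly h n x) = of_real (X x \<omega>)" by (simp add: mult.commute)
      then show ?case by (simp add: Y_def)
    qed
  qed
  moreover have "AE \<omega> in M. smooth (\<lambda>x. Y x \<omega>)"
    using good unfolding Y_def by eventually_elim (rule smooth_newton_series(1)[OF h])
  ultimately show ?thesis
    using Ym unfolding modification_def by blast
qed

section \<open>The fractional Matern field\<close>

definition matern_spectral_density :: "real \<Rightarrow> real \<Rightarrow> real \<Rightarrow> real ^ 'n \<Rightarrow> real" where
  "matern_spectral_density \<sigma> \<kappa> \<alpha> \<xi> = noise_spectral_density \<sigma> \<kappa> \<xi> / (operator_symbol \<kappa> \<alpha> \<xi>)\<^sup>2"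

lemma matern_spectral_density_eq:
  fixes \<xi> :: "real ^ 'n::finite"
  shows "matern_spectral_density \<sigma> \<kappa> \<alpha> \<xi> = indicator (cball 0 \<kappa>) \<xi> *\<^sub>R
    (\<sigma>\<^sup>2 / (2 * pi) ^ CARD('n) / ((\<kappa>\<^sup>2 + (norm \<xi>)\<^sup>2) powr (\<alpha> / 2))\<^sup>2)"
  by (simp add: matern_spectral_density_def noise_spectral_density_def operator_symbol_def)

lemma matern_spectral_density_integrable:
  fixes \<kappa> :: real
  assumes "\<kappa> > 0"
  shows "integrable lborel (matern_spectral_density \<sigma> \<kappa> \<alpha> :: real ^ 'n::finite \<Rightarrow> real)"
proof -
  have "\<kappa>\<^sup>2 + (norm \<xi>)\<^sup>2 > 0" for \<xi> :: "real ^ 'n" using assms by (simp add: add_pos_nonneg)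
  then have nz: "\<kappa>\<^sup>2 + (norm \<xi>)\<^sup>2 \<noteq> 0" for \<xi> :: "real ^ 'n" by (metis less_irrefl)
  have "set_integrable lborel (cball 0 \<kappa>)
      (\<lambda>\<xi> :: real ^ 'n. \<sigma>\<^sup>2 / (2 * pi) ^ CARD('n) / ((\<kappa>\<^sup>2 + (norm \<xi>)\<^sup>2) powr (\<alpha> / 2))\<^sup>2)"
    unfolding set_integrable_def
    by (intro borel_integrable_compact compact_cball continuous_intros) (use nz in auto)
  then show ?thesis unfolding matern_spectral_density_eq[abs_def] set_integrable_def .
qed

lemma matern_variance_pos:
  fixes \<kappa> :: real
  assumes "\<kappa> > 0" "\<sigma>\<^sup>2 > 0"
  shows "integral\<^sup>L lborel (matern_spectral_density \<sigma> \<kappa> \<alpha> :: real ^ 'n::finite \<Rightarrow> real) > 0"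
proof -
  let ?S = "matern_spectral_density \<sigma> \<kappa> \<alpha> :: real ^ 'n \<Rightarrow> real"
  have p: "\<kappa>\<^sup>2 + (norm \<xi>)\<^sup>2 > 0" for \<xi> :: "real ^ 'n" using assms by (simp add: add_pos_nonneg)
  have nn: "?S \<xi> \<ge> 0" for \<xi> by (simp add: matern_spectral_density_eq)
  have pos: "?S \<xi> > 0" if "\<xi> \<in> ball 0 \<kappa>" for \<xi>
  proof -
    have "0 < \<sigma>\<^sup>2 / (2 * pi) ^ CARD('n) / ((\<kappa>\<^sup>2 + (norm \<xi>)\<^sup>2) powr (\<alpha> / 2))\<^sup>2"
      using p[of \<xi>] by (intro divide_pos_pos assms(2) zero_less_power) auto
    then show ?thesis using that unfolding matern_spectral_density_eq by simp
  qed
  have "integral\<^sup>L lborel ?S \<noteq> 0"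
  proof
    assume "integral\<^sup>L lborel ?S = 0"
    then have "AE \<xi> in lborel. ?S \<xi> = 0"
      using integral_nonneg_eq_0_iff_AE[OF matern_spectral_density_integrable[OF assms(1), where \<sigma> = \<sigma> and \<alpha> = \<alpha> and 'n = 'n]] nn
      by simp
    then have "AE \<xi> in lborel. \<xi> \<notin> ball (0 :: real ^ 'n) \<kappa>"
    proof eventually_elim
      case (elim \<xi>)
      with pos[of \<xi>] show ?case by auto
    qed
    then have "emeasure lborel (ball (0 :: real ^ 'n) \<kappa>) = 0"
      by (subst (asm) AE_iff_measurable[of "ball 0 \<kappa>"]) auto
    then show False
      using content_ball_pos[OF assms(1), of "0 :: real ^ 'n"] by (simp add: measure_def)
  qed
  then show ?thesis using Bochner_Integration.integral_nonneg[of lborel ?S] nn by fastforce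
qed

text \<open>
  The Bochner integral of a non-integrable function is \<open>0\<close>. As the variance prescribed by the
  covariance function is positive, the squares of the field values must be integrable, and so are
  the products.
\<close>

lemma matern_field_spectral:
  fixes X :: "real ^ 'n \<Rightarrow> 'w \<Rightarrow> real"
  assumes "prob_space M" "\<sigma>\<^sup>2 > 0" "\<kappa> > 0" and X: "band_limited_matern_field M \<sigma> \<kappa> \<alpha> X"
  shows "spectral_field M X (matern_spectral_density \<sigma> \<kappa> \<alpha>)"
proof -
  interpret prob_space M by fact
  let ?S = "matern_spectral_density \<sigma> \<kappa> \<alpha> :: real ^ 'n \<Rightarrow> real"
  have cov: "complex_of_real (\<integral>\<omega>. X x \<omega> * X y \<omega> \<partial>M)
      = (\<integral>\<xi>. character (x - y) \<xi> * complex_of_real (?S \<xi>) \<partial>lborel)" for x y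
  proof -
    have "complex_of_real (\<integral>\<omega>. X x \<omega> * X y \<omega> \<partial>M) = matern_covariance \<sigma> \<kappa> \<alpha> x y"
      using X by (simp only: band_limited_matern_field_def zero_mean_gaussian_field_def)
    then show ?thesis
      unfolding matern_covariance_spectral character_def matern_spectral_density_def .
  qed
  have [measurable]: "X x \<in> borel_measurable M" for x
  proof -
    \<comment> \<open>A single value is the linear combination over \<open>{x}\<close> with coefficient \<open>1\<close>.\<close>
    have "gaussian_rv M (\<lambda>\<omega>. \<Sum>y\<in>{x}. 1 * X y \<omega>)"
      using X by (simp only: band_limited_matern_field_def zero_mean_gaussian_field_def gaussian_field_def finite.intros simp_thms)
    then show ?thesis by (simp add: gaussian_rv_def)
  qed
  have sq: "integrable M (\<lambda>\<omega>. (X x \<omega>)\<^sup>2)" for x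
  proof (rule ccontr)
    assume "\<not> integrable M (\<lambda>\<omega>. (X x \<omega>)\<^sup>2)"
    then have "(\<integral>\<omega>. X x \<omega> * X x \<omega> \<partial>M) = 0"
      using not_integrable_integral_eq[of M "\<lambda>\<omega>. (X x \<omega>)\<^sup>2"] by (simp add: power2_eq_square)
    then have "complex_of_real (integral\<^sup>L lborel ?S) = 0"
      using cov[of x x] by (simp add: character_def)
    then show False using matern_variance_pos[OF assms(3,2), where 'n='n, of \<alpha>] by simp
  qed
  have "integrable M (\<lambda>\<omega>. X x \<omega> * X y \<omega>)" for x y
  proof (rule Bochner_Integration.integrable_bound)
    show "integrable M (\<lambda>\<omega>. (X x \<omega>)\<^sup>2 + (X y \<omega>)\<^sup>2)" using sq by simp
    have "\<bar>a * b\<bar> \<le> a\<^sup>2 + b\<^sup>2" for a b :: real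
    proof -
      have "2 * (\<bar>a\<bar> * \<bar>b\<bar>) \<le> a\<^sup>2 + b\<^sup>2"
        using sum_squares_bound[of "\<bar>a\<bar>" "\<bar>b\<bar>"] by simp
      moreover have "0 \<le> \<bar>a\<bar> * \<bar>b\<bar>" by simp
      ultimately show ?thesis unfolding abs_mult by linarith
    qed
    then show "AE \<omega> in M. norm (X x \<omega> * X y \<omega>) \<le> norm ((X x \<omega>)\<^sup>2 + (X y \<omega>)\<^sup>2)"
      by (simp add: AE_I2)
  qed measurable
  then show ?thesis
    using cov matern_spectral_density_integrable[OF assms(3), where 'n='n, of \<sigma> \<alpha>]
    by unfold_locales (auto simp: matern_spectral_density_eq)
qed

theorem lemma4p1:
  fixes M :: "'w measure" and X :: "real ^ 'n \<Rightarrow> 'w \<Rightarrow> real"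
    and \<sigma> \<kappa> \<alpha> :: real
  assumes "prob_space M"
    and "\<sigma>\<^sup>2 > 0" and "\<kappa> > 0"
    and "\<alpha> > real CARD('n) / 2" and "\<alpha> \<notin> \<int>"
    and "band_limited_matern_field M \<sigma> \<kappa> \<alpha> X"
  shows "\<exists>Y. modification M Y X \<and> (AE \<omega> in M. smooth (\<lambda>x. Y x \<omega>))"
proof (rule spectral_field_smooth_modification)
  show "spectral_field M X (matern_spectral_density \<sigma> \<kappa> \<alpha>)"
    by (rule matern_field_spectral) fact+
  show "norm \<xi> \<le> \<kappa>" if "matern_spectral_density \<sigma> \<kappa> \<alpha> \<xi> \<noteq> 0" for \<xi> :: "real ^ 'n"
    using that by (simp add: matern_spectral_density_eq indicator_def split: if_splits)
qed fact

end
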